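(* Let $m\ge2$ and let $(\varphi_1,\ldots,\varphi_m;\rho_1,\ldots,\rho_m)$ be a conformal iterated function system on $[0,1]$ with self-conformal measure $\mu=\mu(\varphi_1,\ldots,\varphi_m;\rho_1,\ldots,\rho_m)$. Assume that $\sum_{i=1}^m\|\varphi_i'\|_\infty<1$ and that $(\varphi_1,\ldots,\varphi_m)$ satisfies the strong bounded distortion property. For each $i$ let $x_i$ be the unique fixed point of $\varphi_i$, and put $$S_i(x)=c_i+\varphi_i'(x_i)\,x,\qquad i=1,\ldots,m,$$ where the constants $c_i$ are arbitrary, but chosen in such a way that $(S_1,\ldots,S_m)$ has the same structure as $(\varphi_1,\ldots,\varphi_m)$. Let $\mu_0=\mu_0(S_1,\ldots,S_m;\rho_1,\ldots,\rho_m)$ be the corresponding self-similar measure. Then $\mu$ is a deformed self-similar measure: $\mu=\mu_0\circ g$, i.e. $\mu(E)=\mu_0(g(E))$ for every measurable set $E$, where $g:[0,1]\to[0,1]$ is a $W^1_\infty$ diffeomorphism.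
   Context: Conformal iterated function system on $[0,1]$ ($m\ge2$): a tuple $(\varphi_1,\ldots,\varphi_m;\rho_1,\ldots,\rho_m)$ such that, for some $\gamma>0$: (1) each $\varphi_i:[0,1]\to\varphi_i([0,1])$ is a $C^{1+\gamma}$ diffeomorphism (derivative Hölder continuous with exponent $\gamma$); (2) $\varphi_i((0,1))\subset(0,1)$ and $\varphi_i((0,1))\cap\varphi_j((0,1))=\varnothing$ for $i\ne j$; (3) $0<|\varphi_i'(x)|<1$ for all $i$ and all $x\in[0,1]$; (4) $\rho_i>0$ and $\sum_{i=1}^m\rho_i=1$. The maps are numbered in ascending order: $\varphi_i(x)\le\varphi_{i+1}(y)$ for all $x,y\in[0,1]$. The measure $\mu(\varphi_1,\ldots,\varphi_m;\rho_1,\ldots,\rho_m)$ generated by such a system is the unique Borel probability measure $\mu$ on $[0,1]$ with $\mu(E)=\sum_{i=1}^m\rho_i\,\mu(\varphi_i^{-1}(E))$ for all measurable $E$; it is called self-conformal, and self-similar if all the maps are affine. Words: $\Sigma_k=\{1,\ldots,m\}^k$, $\Sigma_*=\bigcup_{k\ge0}\Sigma_k$; for $w=(i_1,\ldots,i_k)$, $|w|=k$ and $\varphi_w=\varphi_{i_1}\circ\cdots\circ\varphi_{i_k}$. For a permutation $\sigma$ of $\{1,\dots,|w|\}$, $\sigma w$ is the word obtained from $w$ by permuting its letters by $\sigma$. Strong bounded distortion property: there is a constant $C\ge1$ such that $C^{-1}\le\left|\varphi_w'(x)/\varphi_{\sigma w}'(y)\right|\le C$ for all $x,y\in[0,1]$,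 all $w\in\Sigma_*$ and all permutations $\sigma$ of $\{1,\dots,|w|\}$. Same structure: $S_1,\ldots,S_m$ are affine contractions of $[0,1]$ onto subsegments $S_i([0,1])\subset[0,1]$ with pairwise no common interior points, numbered in ascending order, such that: $S_i$ changes orientation if and only if $\varphi_i$ changes orientation; and $S_i([0,1])$ and $S_{i+1}([0,1])$ touch if and only if $\varphi_i([0,1])$ and $\varphi_{i+1}([0,1])$ touch. A $W^1_\infty$ diffeomorphism of $[0,1]$ is a bijection $g:[0,1]\to[0,1]$ such that both $g$ and $g^{-1}$ belong to $W^1_\infty[0,1]$ (i.e. are Lipschitz).
   Formalization: Added assumption: each endpoint 0, 1 lies in the support of μ iff it lies in the support of μ₀. Without it the claim fails, e.g. φ₁=x/3, φ₂=x/3+2/3, S₁=x/3+1/10, S₂=x/3+1/2, equal weights. *)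

theory Defs
  imports "HOL-Analysis.Analysis" "HOL-Combinatorics.Permutations"
begin

text \<open>
  Maps on \<open>[0,1]\<close> are total functions \<open>real \<Rightarrow> real\<close> of which only the values on \<open>{0..1}\<close> matter.
  Accordingly all derivatives are taken within the domain, i.e. one-sided at endpoints. A family
  of \<open>m\<close> maps is a function on indices, read on \<open>{1..m}\<close>.
\<close>

abbreviation deriv01 :: "(real \<Rightarrow> real) \<Rightarrow> real \<Rightarrow> real" where
  "deriv01 f x \<equiv> vector_derivative f (at x within {0..1})"

definition sup_norm01 :: "(real \<Rightarrow> real) \<Rightarrow> real" where
  "sup_norm01 f = (SUP x\<in>{0..1}. \<bar>f x\<bar>)"

definition C1_holder_on :: "real \<Rightarrow> real set \<Rightarrow> (real \<Rightarrow> real) \<Rightarrow> bool" where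
  "C1_holder_on \<gamma> A f \<longleftrightarrow>
     (\<forall>x\<in>A. f differentiable (at x within A)) \<and>
     (\<exists>H. \<forall>x\<in>A. \<forall>y\<in>A.
        \<bar>vector_derivative f (at x within A) - vector_derivative f (at y within A)\<bar>
          \<le> H * \<bar>x - y\<bar> powr \<gamma>)"

definition C1_holder_diffeo_on :: "real \<Rightarrow> real set \<Rightarrow> (real \<Rightarrow> real) \<Rightarrow> bool" where
  "C1_holder_diffeo_on \<gamma> A f \<longleftrightarrow>
     inj_on f A \<and> C1_holder_on \<gamma> A f \<and> C1_holder_on \<gamma> (f ` A) (the_inv_into A f)"

definition ascending :: "nat \<Rightarrow> (nat \<Rightarrow> real \<Rightarrow> real) \<Rightarrow> bool" where
  "ascending m \<phi> \<longleftrightarrow>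
     (\<forall>i\<in>{1..<m}. \<forall>x\<in>{0..1}. \<forall>y\<in>{0..1}. \<phi> i x \<le> \<phi> (Suc i) y)"

definition conformal_ifs :: "nat \<Rightarrow> (nat \<Rightarrow> real \<Rightarrow> real) \<Rightarrow> (nat \<Rightarrow> real) \<Rightarrow> bool" where
  "conformal_ifs m \<phi> \<rho> \<longleftrightarrow>
     (\<exists>\<gamma>>0. \<forall>i\<in>{1..m}. C1_holder_diffeo_on \<gamma> {0..1} (\<phi> i)) \<and>
     (\<forall>i\<in>{1..m}. \<phi> i ` {0<..<1} \<subseteq> {0<..<1}) \<and>
     (\<forall>i\<in>{1..m}. \<forall>j\<in>{1..m}. i \<noteq> j \<longrightarrow> \<phi> i ` {0<..<1} \<inter> \<phi> j ` {0<..<1} = {}) \<and>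
     (\<forall>i\<in>{1..m}. \<forall>x\<in>{0..1}. 0 < \<bar>deriv01 (\<phi> i) x\<bar> \<and> \<bar>deriv01 (\<phi> i) x\<bar> < 1) \<and>
     (\<forall>i\<in>{1..m}. 0 < \<rho> i) \<and> (\<Sum>i=1..m. \<rho> i) = 1 \<and>
     ascending m \<phi>"

text \<open>
  This determines \<open>\<mu>\<close> uniquely when \<open>\<phi>\<close> is a conformal iterated function system or a system of
  affine contractions with probability weights \<open>\<rho>\<close>.
\<close>

definition generated_measure ::
  "nat \<Rightarrow> (nat \<Rightarrow> real \<Rightarrow> real) \<Rightarrow> (nat \<Rightarrow> real) \<Rightarrow> real measure \<Rightarrow> bool" where
  "generated_measure m \<phi> \<rho> \<mu> \<longleftrightarrow>
     space \<mu> = {0..1} \<and> sets \<mu> = sets (restrict_space borel {0..1}) \<and>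
     emeasure \<mu> {0..1} = 1 \<and>
     (\<forall>E\<in>sets \<mu>.
        emeasure \<mu> E = (\<Sum>i=1..m. ennreal (\<rho> i) * emeasure \<mu> (\<phi> i -` E \<inter> {0..1})))"

definition measure_support :: "real measure \<Rightarrow> real set" where
  "measure_support \<mu> =
     {x \<in> space \<mu>. \<forall>U. open U \<and> x \<in> U \<longrightarrow> emeasure \<mu> (U \<inter> space \<mu>) > 0}"

definition word_map :: "(nat \<Rightarrow> real \<Rightarrow> real) \<Rightarrow> nat list \<Rightarrow> real \<Rightarrow> real" where
  "word_map \<phi> w = foldr (\<lambda>i f. \<phi> i \<circ> f) w id"

definition strong_bounded_distortion :: "nat \<Rightarrow> (nat \<Rightarrow> real \<Rightarrow> real) \<Rightarrow> bool" where
  "strong_bounded_distortion m \<phi> \<longleftrightarrow>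
     (\<exists>C\<ge>1. \<forall>w \<sigma>. set w \<subseteq> {1..m} \<longrightarrow> \<sigma> permutes {..<length w} \<longrightarrow>
        (\<forall>x\<in>{0..1}. \<forall>y\<in>{0..1}.
           inverse C \<le> \<bar>deriv01 (word_map \<phi> w) x / deriv01 (word_map \<phi> (permute_list \<sigma> w)) y\<bar> \<and>
           \<bar>deriv01 (word_map \<phi> w) x / deriv01 (word_map \<phi> (permute_list \<sigma> w)) y\<bar> \<le> C))"

definition affine_contraction01 :: "(real \<Rightarrow> real) \<Rightarrow> bool" where
  "affine_contraction01 f \<longleftrightarrow>
     (\<exists>a b. 0 < \<bar>a\<bar> \<and> \<bar>a\<bar> < 1 \<and> (\<forall>x\<in>{0..1}. f x = b + a * x))"

abbreviation changes_orientation :: "(real \<Rightarrow> real) \<Rightarrow> bool" where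
  "changes_orientation f \<equiv> strict_antimono_on {0..1} f"

definition same_structure ::
  "nat \<Rightarrow> (nat \<Rightarrow> real \<Rightarrow> real) \<Rightarrow> (nat \<Rightarrow> real \<Rightarrow> real) \<Rightarrow> bool" where
  "same_structure m S \<phi> \<longleftrightarrow>
     (\<forall>i\<in>{1..m}. affine_contraction01 (S i) \<and> S i ` {0..1} \<subseteq> {0..1}) \<and>
     (\<forall>i\<in>{1..m}. \<forall>j\<in>{1..m}. i \<noteq> j \<longrightarrow>
        interior (S i ` {0..1}) \<inter> interior (S j ` {0..1}) = {}) \<and>
     ascending m S \<and>
     (\<forall>i\<in>{1..m}. changes_orientation (S i) \<longleftrightarrow> changes_orientation (\<phi> i)) \<and>
     (\<forall>i\<in>{1..<m}. S i ` {0..1} \<inter> S (Suc i) ` {0..1} \<noteq> {} \<longleftrightarrow>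
        \<phi> i ` {0..1} \<inter> \<phi> (Suc i) ` {0..1} \<noteq> {})"

text \<open>
  On the interval, membership in \<open>W\<^sup>1\<^sub>\<infinity>\<close> is the same as being Lipschitz.
\<close>

definition W1inf_diffeo01 :: "(real \<Rightarrow> real) \<Rightarrow> bool" where
  "W1inf_diffeo01 g \<longleftrightarrow>
     bij_betw g {0..1} {0..1} \<and>
     (\<exists>L. L-lipschitz_on {0..1} g) \<and>
     (\<exists>L. L-lipschitz_on {0..1} (the_inv_into {0..1} g))"

end

theory Submission
  imports Defs
begin

text \<open>
  Let \<open>[a,b]\<close> and \<open>[A,B]\<close> be the convex hulls of the supports of \<open>\<mu>\<close> and \<open>\<mu>\<^sub>0\<close>. On \<open>[a,b]\<close> there is an
  increasing \<open>g\<close> with \<open>g \<circ> \<phi>\<^sub>i = S\<^sub>i \<circ> g\<close>: it is the limit of maps \<open>g\<^sub>n\<close>, where \<open>g\<^sub>n\<^sub>+\<^sub>1\<close> equals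
  \<open>S\<^sub>i \<circ> g\<^sub>n \<circ> \<phi>\<^sub>i\<inverse>\<close> on the \<open>i\<close>-th piece and is affine on the gaps between consecutive pieces.
  Sorting the letters of a word reduces strong bounded distortion to powers of single maps, whose
  derivative at the fixed point is known, so \<open>\<bar>\<phi>\<^sub>w'\<bar>\<close> is comparable with \<open>\<bar>S\<^sub>w'\<bar>\<close> uniformly in \<open>w\<close>.
  Hence the bound that the increments of \<open>S\<^sub>w \<circ> g\<^sub>n\<close> are comparable with those of \<open>\<phi>\<^sub>w\<close>, for all words
  \<open>w\<close> simultaneously, passes from \<open>g\<^sub>n\<close> to \<open>g\<^sub>n\<^sub>+\<^sub>1\<close> with the same constant, and \<open>w = []\<close> shows that \<open>g\<close>
  is bi-Lipschitz. Extended affinely to \<open>[0,1]\<close>, it pushes \<open>\<mu>\<close> forward to a measure generated by \<open>S\<close>,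
  which is \<open>\<mu>\<^sub>0\<close> by uniqueness.
\<close>

section \<open>Monotone systems on an interval and comparable increments\<close>

text \<open>Increments of \<open>h\<close> are signed: for \<open>0 < L\<close> and nonnegative
  \<open>D\<close> the second inequality makes \<open>h\<close> nondecreasing. With
  \<open>D x y = y - x\<close> the single condition says that \<open>h\<close> is increasing and
  bi-Lipschitz.\<close>

definition comparable_increments ::
  "real \<Rightarrow> (real \<Rightarrow> real \<Rightarrow> real) \<Rightarrow> (real \<Rightarrow> real) \<Rightarrow> real \<Rightarrow> real \<Rightarrow> bool" where
  "comparable_increments L D h u v \<longleftrightarrow>
     (\<forall>x y. u \<le> x \<longrightarrow> x \<le> y \<longrightarrow> y \<le> v \<longrightarrow> h y - h x \<le> L * D x y \<and> D x y \<le> L * (h y - h x))"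

lemma comparable_incrementsI:
  assumes "\<And>x y. \<lbrakk>u \<le> x; x \<le> y; y \<le> v\<rbrakk> \<Longrightarrow> h y - h x \<le> L * D x y"
    and "\<And>x y. \<lbrakk>u \<le> x; x \<le> y; y \<le> v\<rbrakk> \<Longrightarrow> D x y \<le> L * (h y - h x)"
  shows "comparable_increments L D h u v"
  using assms by (simp add: comparable_increments_def)

lemma comparable_incrementsD:
  assumes "comparable_increments L D h u v" "u \<le> x" "x \<le> y" "y \<le> v"
  shows "h y - h x \<le> L * D x y" "D x y \<le> L * (h y - h x)"
  using assms by (simp_all add: comparable_increments_def)

lemma comparable_increments_cong:
  assumes "comparable_increments L D h u v" "\<And>x. \<lbrakk>u \<le> x; x \<le> v\<rbrakk> \<Longrightarrow> h' x = h x"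
  shows "comparable_increments L D h' u v"
proof -
  have "h' y - h' x = h y - h x" if "u \<le> x" "x \<le> y" "y \<le> v" for x y
    using assms(2)[of x] assms(2)[of y] that by simp
  then show ?thesis using assms(1) by (simp add: comparable_increments_def)
qed

lemma comparable_increments_join:
  assumes "comparable_increments L D h u v" "comparable_increments L D h v z"
    and add: "\<And>x y. \<lbrakk>u \<le> x; x \<le> v; v \<le> y; y \<le> z\<rbrakk> \<Longrightarrow> D x y = D x v + D v y"
  shows "comparable_increments L D h u z"
  unfolding comparable_increments_def
proof (intro allI impI)
  fix x y assume xy: "u \<le> x" "x \<le> y" "y \<le> z"
  consider "y \<le> v" | "v \<le> x" | "x \<le> v" "v \<le> y" by linarith
  then show "h y - h x \<le> L * D x y \<and> D x y \<le> L * (h y - h x)"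
  proof cases
    case 3
    have "h v - h x \<le> L * D x v" "D x v \<le> L * (h v - h x)"
      using comparable_incrementsD[OF assms(1), of x v] xy 3 by auto
    moreover have "h y - h v \<le> L * D v y" "D v y \<le> L * (h y - h v)"
      using comparable_incrementsD[OF assms(2), of v y] xy 3 by auto
    moreover have "D x y = D x v + D v y" using add[of x y] xy 3 by blast
    ultimately show ?thesis by (simp add: algebra_simps)
  next
    case 1
    then show ?thesis using comparable_incrementsD[OF assms(1) xy(1,2)] by blast
  next
    case 2
    then show ?thesis using comparable_incrementsD[OF assms(2) _ xy(2,3)] by blast
  qed
qed

lemma comparable_increments_affine:
  assumes M: "comparable_increments M D (\<lambda>x. x) u v"
    and D: "\<And>x y. \<lbrakk>u \<le> x; x \<le> y; y \<le> v\<rbrakk> \<Longrightarrow> 0 \<le> D x y"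
    and k: "0 < k" "M * k \<le> L" "M / k \<le> L"
  shows "comparable_increments L D (\<lambda>x. e + k * (x - x0)) u v"
proof (rule comparable_incrementsI)
  fix x y assume xy: "u \<le> x" "x \<le> y" "y \<le> v"
  note * = comparable_incrementsD[OF M xy]
  have "e + k * (y - x0) - (e + k * (x - x0)) = k * (y - x)" by (simp add: algebra_simps)
  moreover have "k * (y - x) \<le> k * (M * D x y)" using * k by simp
  moreover have "M * k * D x y \<le> L * D x y" using D[OF xy] k by (intro mult_right_mono) auto
  ultimately show "e + k * (y - x0) - (e + k * (x - x0)) \<le> L * D x y" 
    by (simp add: algebra_simps)
  have "D x y \<le> M / k * (k * (y - x))" using * k by simp
  also have "\<dots> \<le> L * (k * (y - x))" using k xy by (intro mult_right_mono) auto
  finally show "D x y \<le> L * (e + k * (y - x0) - (e + k * (x - x0)))"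
    by (simp add: algebra_simps)
qed

lemma glue_at:
  fixes h1 h2 :: "real \<Rightarrow> 'a"
  assumes "h1 v = h2 v"
  obtains h where "\<And>x. x \<le> v \<Longrightarrow> h x = h1 x" "\<And>x. v \<le> x \<Longrightarrow> h x = h2 x"
  using that[of "\<lambda>x. if x \<le> v then h1 x else h2 x"] assms by (auto dest: antisym)

section \<open>Words and systems of monotone maps of an interval\<close>

lemma word_map_Nil [simp]: "word_map f [] = (\<lambda>y. y)"
  by (simp add: word_map_def id_def)

lemma word_map_Cons [simp]: "word_map f (i # w) = (\<lambda>y. f i (word_map f w y))"
  by (simp add: word_map_def o_def)

lemma word_map_append [simp]: "word_map f (v @ w) = (\<lambda>y. word_map f v (word_map f w y))"
  by (induction v) auto

text \<open>The orientations \<open>up\<close> are a parameter of their own, so that two systems can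
  share them.\<close>

locale hull_system =
  fixes m :: nat and f :: "nat \<Rightarrow> real \<Rightarrow> real" and up :: "nat \<Rightarrow> bool" and a b :: real
  assumes m_pos: "1 \<le> m"
    and hull_less: "a < b"
    and maps_hull: "\<lbrakk>i \<in> {1..m}; y \<in> {a..b}\<rbrakk> \<Longrightarrow> f i y \<in> {a..b}"
    and continuous_hull: "i \<in> {1..m} \<Longrightarrow> continuous_on {a..b} (f i)"
    and increasing_hull: "\<lbrakk>i \<in> {1..m}; up i\<rbrakk> \<Longrightarrow> strict_mono_on {a..b} (f i)"
    and decreasing_hull: "\<lbrakk>i \<in> {1..m}; \<not> up i\<rbrakk> \<Longrightarrow> strict_antimono_on {a..b} (f i)"
begin

definition lo :: "nat \<Rightarrow> real" where "lo i = f i (if up i then a else b)"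
definition hi :: "nat \<Rightarrow> real" where "hi i = f i (if up i then b else a)"

lemma lo_less_hi: "i \<in> {1..m} \<Longrightarrow> lo i < hi i"
  using increasing_hull[of i] decreasing_hull[of i] hull_less
  by (auto simp: lo_def hi_def monotone_on_def)

lemma lo_le: "\<lbrakk>i \<in> {1..m}; y \<in> {a..b}\<rbrakk> \<Longrightarrow> lo i \<le> f i y"
  and le_hi: "\<lbrakk>i \<in> {1..m}; y \<in> {a..b}\<rbrakk> \<Longrightarrow> f i y \<le> hi i"
proof -
  assume i: "i \<in> {1..m}" and y: "y \<in> {a..b}"
  have "lo i \<le> f i y \<and> f i y \<le> hi i"
  proof (cases "up i")
    case True
    then have "mono_on {a..b} (f i)"
      using increasing_hull[OF i] strict_mono_on_imp_mono_on by blast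
    then show ?thesis using y True hull_less by (auto simp: lo_def hi_def monotone_on_def)
  next
    case False
    then have "antimono_on {a..b} (f i)"
      using decreasing_hull[OF i] by (simp add: strict_antimono_iff_antimono)
    then show ?thesis using y False hull_less by (auto simp: lo_def hi_def monotone_on_def)
  qed
  then show "lo i \<le> f i y" "f i y \<le> hi i" by auto
qed

lemma inj_on_hull: "i \<in> {1..m} \<Longrightarrow> inj_on (f i) {a..b}"
  using increasing_hull[of i] decreasing_hull[of i]
  by (cases "up i") (auto simp: strict_mono_iff_mono strict_antimono_iff_antimono)

lemma image_hull: 
  assumes i: "i \<in> {1..m}" shows "f i ` {a..b} = {lo i..hi i}"
proof
  show "f i ` {a..b} \<subseteq> {lo i..hi i}" using lo_le[OF i] le_hi[OF i] by auto
  have "connected (f i ` {a..b})" using continuous_hull[OF i] 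
    by (intro connected_continuous_image) auto
  moreover have "lo i \<in> f i ` {a..b}" "hi i \<in> f i ` {a..b}"
    using hull_less by (auto simp: lo_def hi_def)
  ultimately show "{lo i..hi i} \<subseteq> f i ` {a..b}"
    using connected_contains_Icc by blast
qed

lemma word_map_hull:
  "\<lbrakk>set w \<subseteq> {1..m}; y \<in> {a..b}\<rbrakk> \<Longrightarrow> word_map f w y \<in> {a..b}"
  by (induction w) (use maps_hull in auto)

lemma word_map_monotone:
  "set w \<subseteq> {1..m} \<Longrightarrow> mono_on {a..b} (word_map f w) \<or> antimono_on {a..b} (word_map f w)"
proof (induction w)
  case Nil
  then show ?case by (simp add: monotone_on_def)
next
  case (Cons i w)
  have w: "word_map f w y \<in> {a..b}" if "y \<in> {a..b}" for y
    using Cons.prems that word_map_hull by auto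
  have "mono_on {a..b} (f i) \<or> antimono_on {a..b} (f i)"
    using increasing_hull[of i] decreasing_hull[of i] Cons.prems
    by (cases "up i") (auto simp: strict_mono_iff_mono strict_antimono_iff_antimono)
  moreover have "mono_on {a..b} (word_map f w) \<or> antimono_on {a..b} (word_map f w)"
    using Cons by simp
  ultimately consider
      "mono_on {a..b} (f i)" "mono_on {a..b} (word_map f w)"
    | "mono_on {a..b} (f i)" "antimono_on {a..b} (word_map f w)"
    | "antimono_on {a..b} (f i)" "mono_on {a..b} (word_map f w)"
    | "antimono_on {a..b} (f i)" "antimono_on {a..b} (word_map f w)"
    by blast
  then show ?case
  proof cases
    case 1
    then have "mono_on {a..b} (word_map f (i # w))" using w by (simp add: monotone_on_def)
    then show ?thesis ..
  next
    case 2
    then have "antimono_on {a..b} (word_map f (i # w))" using w by (simp add: monotone_on_def)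
    then show ?thesis ..
  next
    case 3
    then have "antimono_on {a..b} (word_map f (i # w))" using w by (simp add: monotone_on_def)
    then show ?thesis ..
  next
    case 4
    then have "mono_on {a..b} (word_map f (i # w))" using w by (simp add: monotone_on_def)
    then show ?thesis ..
  qed
qed

text \<open>Compositions of monotone maps are monotone, so distances of images add up along ordered
  points. This is what lets comparisons on adjacent intervals be joined.\<close>

lemma word_map_additive:
  assumes "set w \<subseteq> {1..m}" "a \<le> x" "x \<le> y" "y \<le> z" "z \<le> b"
  shows "\<bar>word_map f w x - word_map f w z\<bar> =
    \<bar>word_map f w x - word_map f w y\<bar> + \<bar>word_map f w y - word_map f w z\<bar>"
  using word_map_monotone[OF assms(1)]
proof
  assume "mono_on {a..b} (word_map f w)"
  then have "word_map f w x \<le> word_map f w y" "word_map f w y \<le> word_map f w z"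
    using assms by (auto simp: monotone_on_def)
  then show ?thesis by linarith
next
  assume "antimono_on {a..b} (word_map f w)"
  then have "word_map f w x \<ge> word_map f w y" "word_map f w y \<ge> word_map f w z"
    using assms by (auto simp: monotone_on_def)
  then show ?thesis by linarith
qed

end

locale tight_hull_system = hull_system +
  assumes lo_first: "lo 1 = a"
    and hi_last: "hi m = b"
    and hi_le_lo: "i \<in> {1..<m} \<Longrightarrow> hi i \<le> lo (Suc i)"
begin

lemma hull_cover:
  assumes "x \<in> {a..b}"
  obtains (image) i y where "i \<in> {1..m}" "y \<in> {a..b}" "x = f i y"
  | (gap) i where "i \<in> {1..<m}" "x \<in> {hi i..lo (Suc i)}"
proof -
  \<comment> \<open>The pieces are swept from left to right: induction on \<open>k\<close> treats
    the points up to \<open>hi k\<close>, and \<open>hi m = b\<close> finishes the hull.\<close>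
  have "1 \<le> k \<Longrightarrow> k \<le> m \<Longrightarrow> x \<le> hi k \<Longrightarrow> (\<exists>i\<in>{1..m}. \<exists>y\<in>{a..b}. x = f i y) \<or>
      (\<exists>i\<in>{1..<m}. x \<in> {hi i..lo (Suc i)})" for k
  proof (induction k rule: dec_induct)
    case base
    then have "x \<in> f 1 ` {a..b}" using image_hull[of 1] assms lo_first m_pos by simp
    then show ?case using m_pos by fastforce
  next
    case (step k)
    show ?case
    proof (cases "x \<le> hi k")
      case True
      then show ?thesis using step by simp
    next
      case False
      show ?thesis
      proof (cases "x \<le> lo (Suc k)")
        case True
        then show ?thesis using False step by (intro disjI2 bexI[of _ k]) auto
      next
        case F: False
        then have "x \<in> f (Suc k) ` {a..b}" using image_hull[of "Suc k"] step by auto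
        then show ?thesis using step by (intro disjI1 bexI[of _ "Suc k"]) auto
      qed
    qed
  qed
  from this[of m] show ?thesis using assms hi_last m_pos image gap by auto
qed

end

section \<open>The conjugacy between two systems\<close>

lemma uniform_contraction_ratio:
  fixes d :: "nat \<Rightarrow> real"
  assumes "\<And>i. i \<in> {1..m} \<Longrightarrow> \<bar>d i\<bar> < 1"
  obtains r where "0 \<le> r" "r < 1" "\<And>i. i \<in> {1..m} \<Longrightarrow> \<bar>d i\<bar> \<le> r"
proof
  \<comment> \<open>Inserting 0 keeps the maximum defined for \<open>m = 0\<close> and makes it
    nonnegative.\<close>
  let ?R = "insert 0 ((\<lambda>i. \<bar>d i\<bar>) ` {1..m})"
  show "0 \<le> Max ?R" by (rule Max_ge) auto
  show "Max ?R < 1" using assms by (subst Max_less_iff) auto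
  show "\<bar>d i\<bar> \<le> Max ?R" if "i \<in> {1..m}" for i using that by (intro Max_ge) auto
qed

text \<open>If the affine partners have slopes \<open>d i\<close>, the denominator is the absolute
  slope of the composed affine map. Comparing increments of \<open>h\<close> with this quantity
  therefore compares increments of \<open>word_map s w \<circ> h\<close> with those of
  \<open>word_map f w\<close>.\<close>

definition scaled_dist ::
  "(nat \<Rightarrow> real \<Rightarrow> real) \<Rightarrow> (nat \<Rightarrow> real) \<Rightarrow> nat list \<Rightarrow> real \<Rightarrow> real \<Rightarrow> real" where
  "scaled_dist f d w x y = \<bar>word_map f w x - word_map f w y\<bar> / \<bar>prod_list (map d w)\<bar>"

lemma scaled_dist_nonneg: "0 \<le> scaled_dist f d w x y"
  by (simp add: scaled_dist_def)

lemma scaled_dist_commute: "scaled_dist f d w x y = scaled_dist f d w y x"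
  by (simp add: scaled_dist_def abs_minus_commute)

text \<open>The last letter acts first, so lengthening a word at its end trades a pair of points for
  its image under \<open>f i\<close>.\<close>

lemma scaled_dist_snoc:
  "scaled_dist f d (w @ [i]) x y = scaled_dist f d w (f i x) (f i y) / \<bar>d i\<bar>"
  by (simp add: scaled_dist_def abs_mult)

text \<open>\<open>distortion\<close> holds with one \<open>M\<close> for all words, which is the
  uniform comparability of the derivatives of both systems. By \<open>touch_iff\<close> a gap
  degenerates in one system exactly when it does in the other, so gaps can be mapped onto gaps
  bijectively.\<close>

locale paired_hull_systems =
  F: tight_hull_system m f up a b + G: tight_hull_system m s up A B
  for m :: nat and f s :: "nat \<Rightarrow> real \<Rightarrow> real" and up :: "nat \<Rightarrow> bool" and a b A B :: real +
  fixes c d :: "nat \<Rightarrow> real" and M :: real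
  assumes affine: "i \<in> {1..m} \<Longrightarrow> s i y = c i + d i * y"
    and slope_nonzero: "i \<in> {1..m} \<Longrightarrow> d i \<noteq> 0"
    and slope_less_1: "i \<in> {1..m} \<Longrightarrow> \<bar>d i\<bar> < 1"
    and touch_iff: "i \<in> {1..<m} \<Longrightarrow> F.hi i = F.lo (Suc i) \<longleftrightarrow> G.hi i = G.lo (Suc i)"
    and distortion: "set w \<subseteq> {1..m} \<Longrightarrow>
      comparable_increments M (scaled_dist f d w) (\<lambda>x. x) a b"
begin

lemma slope_sign: "i \<in> {1..m} \<Longrightarrow> up i \<longleftrightarrow> 0 < d i"
proof -
  assume i: "i \<in> {1..m}"
  have "up i \<longleftrightarrow> s i A < s i B"
    using G.increasing_hull[OF i] G.decreasing_hull[OF i] G.hull_less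
    by (cases "up i") (auto simp: monotone_on_def not_less intro: less_imp_le)
  also have "\<dots> \<longleftrightarrow> 0 < d i" 
    using G.hull_less by (auto simp: affine[OF i] mult_less_cancel_left not_le)
  finally show ?thesis .
qed

lemma M_ge_1: "1 \<le> M"
proof -
  have "b - a \<le> M * scaled_dist f d [] a b"
    using comparable_incrementsD(1)[OF distortion[of "[]"], of a b] F.hull_less by simp
  then have "1 * (b - a) \<le> M * (b - a)" using F.hull_less by (simp add: scaled_dist_def)
  then show ?thesis using F.hull_less by (simp add: mult_le_cancel_right)
qed

lemma scaled_dist_additive:
  assumes "set w \<subseteq> {1..m}" "a \<le> x" "x \<le> y" "y \<le> z" "z \<le> b"
  shows "scaled_dist f d w x z = scaled_dist f d w x y + scaled_dist f d w y z"
  using F.word_map_additive[OF assms] by (simp add: scaled_dist_def add_divide_distrib)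

text \<open>All words are needed at once: the bound for \<open>w\<close> on a refined map comes from
  the bound for \<open>w @ [i]\<close> on the previous one.\<close>

definition compatible :: "real \<Rightarrow> (real \<Rightarrow> real) \<Rightarrow> real \<Rightarrow> real \<Rightarrow> bool" where
  "compatible L h u v \<longleftrightarrow>
     (\<forall>w. set w \<subseteq> {1..m} \<longrightarrow> comparable_increments L (scaled_dist f d w) h u v)"

lemma compatible_join:
  assumes "compatible L h u v" "compatible L h v z" "a \<le> u" "z \<le> b"
  shows "compatible L h u z"
  unfolding compatible_def
proof (intro allI impI)
  fix w assume w: "set w \<subseteq> {1..m}"
  show "comparable_increments L (scaled_dist f d w) h u z"
  proof (rule comparable_increments_join)
    show "comparable_increments L (scaled_dist f d w) h u v"
      "comparable_increments L (scaled_dist f d w) h v z"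
      using assms w by (auto simp: compatible_def)
    fix x y assume "u \<le> x" "x \<le> v" "v \<le> y" "y \<le> z"
    then show "scaled_dist f d w x y = scaled_dist f d w x v + scaled_dist f d w v y"
      using assms by (intro scaled_dist_additive w) auto
  qed
qed

lemma compatible_cong:
  assumes "compatible L h u v" "\<And>x. \<lbrakk>u \<le> x; x \<le> v\<rbrakk> \<Longrightarrow> h' x = h x"
  shows "compatible L h' u v"
  using assms comparable_increments_cong[of L _ h u v h'] unfolding compatible_def by blast

lemma compatible_affine:
  assumes "0 < k" "M * k \<le> L" "M / k \<le> L" "a \<le> u" "v \<le> b"
  shows "compatible L (\<lambda>x. e + k * (x - x0)) u v"
  unfolding compatible_def
proof (intro allI impI)
  fix w assume w: "set w \<subseteq> {1..m}"
  have "comparable_increments M (scaled_dist f d w) (\<lambda>x. x) u v"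
    using distortion[OF w] assms(4,5) unfolding comparable_increments_def by simp
  then show "comparable_increments L (scaled_dist f d w) (\<lambda>x. e + k * (x - x0)) u v"
    using assms by (intro comparable_increments_affine) (auto simp: scaled_dist_nonneg)
qed

text \<open>On the \<open>i\<close>-th piece, the increment of \<open>h\<close> and the scaled
  distance for \<open>w\<close> are both \<open>\<bar>d i\<bar>\<close> times the corresponding
  quantities for \<open>g\<close> and \<open>w @ [i]\<close>. The factor cancels, so
  \<open>L\<close> is preserved.\<close>

lemma compatible_image:
  assumes i: "i \<in> {1..m}" and g: "compatible L g a b"
    and h: "\<And>y. y \<in> {a..b} \<Longrightarrow> h (f i y) = s i (g y)"
  shows "compatible L h (F.lo i) (F.hi i)"
  unfolding compatible_def
proof (intro allI impI comparable_incrementsI)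
  fix w x y assume w: "set w \<subseteq> {1..m}" and xy: "F.lo i \<le> x" "x \<le> y" "y \<le> F.hi i"
  then have "x \<in> f i ` {a..b}" "y \<in> f i ` {a..b}" using F.image_hull[OF i] by auto
  then obtain x' y' where x': "x' \<in> {a..b}" "x = f i x'" and y': "y' \<in> {a..b}" "y = f i y'"
    by blast
  have dd: "scaled_dist f d (w @ [i]) x' y' = scaled_dist f d w x y / \<bar>d i\<bar>"
    "scaled_dist f d (w @ [i]) y' x' = scaled_dist f d w x y / \<bar>d i\<bar>"
    by (simp_all add: scaled_dist_snoc x' y' scaled_dist_commute)
  have gw: "comparable_increments L (scaled_dist f d (w @ [i])) g a b"
    using g w i by (simp add: compatible_def)
  have d0: "0 < \<bar>d i\<bar>" using slope_nonzero[OF i] by simp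
  define r where "r = h y - h x"
  have r: "r = d i * (g y' - g x')"
    using h[OF x'(1)] h[OF y'(1)] x'(2) y'(2) by (simp add: r_def affine[OF i] algebra_simps)
  \<comment> \<open>\<open>e\<close> is the increment of \<open>g\<close> between the preimages
    taken in increasing order: an orientation-reversing map swaps them, and the negative sign of
    \<open>d i\<close> compensates.\<close>
  define e where "e = r / \<bar>d i\<bar>"
  have "e \<le> L * (scaled_dist f d w x y / \<bar>d i\<bar>) \<and> scaled_dist f d w x y / \<bar>d i\<bar> \<le> L * e"
  proof (cases "up i")
    case True
    have "x' \<le> y'"
    proof (rule ccontr)
      assume "\<not> x' \<le> y'"
      then have "f i y' < f i x'"
        using F.increasing_hull[OF i True] x' y' by (auto simp: monotone_on_def)
      then show False using xy x' y' by simp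
    qed
    moreover have "e = g y' - g x'" using slope_sign[OF i] True r by (simp add: e_def)
    ultimately show ?thesis using comparable_incrementsD[OF gw, of x' y'] dd x' y' by auto
  next
    case False
    have "y' \<le> x'"
    proof (rule ccontr)
      assume "\<not> y' \<le> x'"
      then have "f i y' < f i x'"
        using F.decreasing_hull[OF i False] x' y' by (auto simp: monotone_on_def)
      then show False using xy x' y' by simp
    qed
    moreover have "e = g x' - g y'" using slope_sign[OF i] False r slope_nonzero[OF i]
      by (simp add: e_def field_simps)
    ultimately show ?thesis using comparable_incrementsD[OF gw, of y' x'] dd x' y' by auto
  qed
  then have "r \<le> L * scaled_dist f d w x y \<and> scaled_dist f d w x y \<le> L * r"
    using d0 by (simp add: e_def divide_le_cancel)
  then show "h y - h x \<le> L * scaled_dist f d w x y" "scaled_dist f d w x y \<le> L * (h y - h x)"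
    by (simp_all add: r_def)
qed

text \<open>Slope of the affine bijection between corresponding gaps. For touching pieces both
  differences vanish and the value is 0 because division by zero gives 0; its reciprocal is then 0
  as well.\<close>

definition gap_slope :: "nat \<Rightarrow> real" where
  "gap_slope i = (G.lo (Suc i) - G.hi i) / (F.lo (Suc i) - F.hi i)"

definition gap_map :: "nat \<Rightarrow> real \<Rightarrow> real" where
  "gap_map i x = G.hi i + gap_slope i * (x - F.hi i)"

lemma gap_map_ends:
  assumes "i \<in> {1..<m}"
  shows "gap_map i (F.hi i) = G.hi i" "gap_map i (F.lo (Suc i)) = G.lo (Suc i)"
  using touch_iff[OF assms] by (auto simp: gap_map_def gap_slope_def)

lemma gap_slope_pos:
  assumes "i \<in> {1..<m}" "F.hi i < F.lo (Suc i)"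
  shows "0 < gap_slope i"
  using touch_iff[OF assms(1)] assms(2) G.hi_le_lo[OF assms(1)] by (auto simp: gap_slope_def)

lemma gap_slope_nonneg: "i \<in> {1..<m} \<Longrightarrow> 0 \<le> gap_slope i"
  using G.hi_le_lo[of i] F.hi_le_lo[of i] by (simp add: gap_slope_def)

lemma compatible_trivial: "compatible L h u u"
  by (auto simp: compatible_def comparable_increments_def scaled_dist_def dest: antisym)

lemma lo_hi_in_hull:
  assumes "i \<in> {1..m}" shows "F.lo i \<in> {a..b}" "F.hi i \<in> {a..b}"
  using F.maps_hull[OF assms] F.hull_less by (auto simp: F.lo_def F.hi_def)

lemma compatible_gap:
  assumes i: "i \<in> {1..<m}" and L: "M * gap_slope i \<le> L" "M / gap_slope i \<le> L"
  shows "compatible L (gap_map i) (F.hi i) (F.lo (Suc i))"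
proof (cases "F.hi i < F.lo (Suc i)")
  case True
  have "compatible L (\<lambda>x. G.hi i + gap_slope i * (x - F.hi i)) (F.hi i) (F.lo (Suc i))"
    using L gap_slope_pos[OF i True] lo_hi_in_hull[of i] lo_hi_in_hull[of "Suc i"] i
    by (intro compatible_affine) auto
  then show ?thesis by (simp add: gap_map_def[abs_def])
next
  case False
  then have "F.lo (Suc i) = F.hi i" using F.hi_le_lo[OF i] by simp
  then show ?thesis by (simp add: compatible_trivial)
qed

definition refines :: "(real \<Rightarrow> real) \<Rightarrow> (real \<Rightarrow> real) \<Rightarrow> bool" where
  "refines g h \<longleftrightarrow> (\<forall>i\<in>{1..m}. \<forall>y\<in>{a..b}. h (f i y) = s i (g y)) \<and>
     (\<forall>i\<in>{1..<m}. \<forall>x\<in>{F.hi i..F.lo (Suc i)}. h x = gap_map i x)"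

lemma refined_ends:
  assumes "i \<in> {1..m}" "g a = A" "g b = B" "\<And>y. y \<in> {a..b} \<Longrightarrow> h (f i y) = s i (g y)"
  shows "h (F.lo i) = G.lo i" "h (F.hi i) = G.hi i"
  using assms(2-) F.hull_less by (auto simp: F.lo_def F.hi_def G.lo_def G.hi_def)

text \<open>Since \<open>g\<close> sends \<open>a\<close> and \<open>b\<close> to \<open>A\<close>
  and \<open>B\<close>, the prescribed values on pieces and gaps agree at their common endpoints and
  can be glued. Each part satisfies the bound with the same \<open>L\<close>, and joining preserves
  it.\<close>

lemma refinement_exists:
  assumes g: "compatible L g a b" "g a = A" "g b = B"
    and L: "\<And>i. i \<in> {1..<m} \<Longrightarrow> M * gap_slope i \<le> L"
      "\<And>i. i \<in> {1..<m} \<Longrightarrow> M / gap_slope i \<le> L"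
  shows "\<exists>h. compatible L h a b \<and> h a = A \<and> h b = B \<and> refines g h"
proof -
  define piece where "piece i x = s i (g (inv_into {a..b} (f i) x))" for i x
  have piece: "piece i (f i y) = s i (g y)" if "i \<in> {1..m}" "y \<in> {a..b}" for i y
    using F.inj_on_hull[OF that(1)] that(2) by (simp add: piece_def)
  have piece_lo: "piece i (F.lo i) = G.lo i" if "i \<in> {1..m}" for i
    using refined_ends[OF that g(2,3), of "piece i"] piece[OF that] by auto
  have piece_comp: "compatible L (piece i) (F.lo i) (F.hi i)" if "i \<in> {1..m}" for i
    using compatible_image[OF that g(1)] piece[OF that] by blast
  \<comment> \<open>The map is built up to the end of the \<open>k\<close>-th piece; each induction
    step glues on the \<open>k\<close>-th gap and the next piece.\<close>
  have "\<exists>h. compatible L h a (F.hi k) \<and>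
      (\<forall>i\<in>{1..k}. \<forall>y\<in>{a..b}. h (f i y) = s i (g y)) \<and>
      (\<forall>i\<in>{1..<k}. \<forall>x\<in>{F.hi i..F.lo (Suc i)}. h x = gap_map i x)" (is "\<exists>h. ?P k h")
    if "1 \<le> k" "k \<le> m" for k
    using that
  proof (induction k rule: dec_induct)
    case base
    have "?P 1 (piece 1)"
      using piece_comp[of 1] piece[of 1] F.lo_first F.m_pos by auto
    then show ?case by blast
  next
    case (step k)
    then obtain h where h: "?P k h" by auto
    have k: "k \<in> {1..m}" "k \<in> {1..<m}" "Suc k \<in> {1..m}" using step by auto
    have hk: "h (F.hi k) = G.hi k"
      using refined_ends[OF k(1) g(2,3), of h] h k by auto
    obtain h1 where h1: "\<And>x. x \<le> F.hi k \<Longrightarrow> h1 x = h x" "\<And>x. F.hi k \<le> x \<Longrightarrow> h1 x = gap_map k x"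
      using glue_at[of h "F.hi k" "gap_map k"] hk gap_map_ends[OF k(2)] by metis
    have "h1 (F.lo (Suc k)) = G.lo (Suc k)"
      using h1(2) F.hi_le_lo[OF k(2)] gap_map_ends[OF k(2)] by simp
    then obtain h2 where h2: "\<And>x. x \<le> F.lo (Suc k) \<Longrightarrow> h2 x = h1 x"
      "\<And>x. F.lo (Suc k) \<le> x \<Longrightarrow> h2 x = piece (Suc k) x"
      using glue_at[of h1 "F.lo (Suc k)" "piece (Suc k)"] piece_lo[OF k(3)] by metis
    have le: "F.hi k \<le> F.lo (Suc k)" using F.hi_le_lo[OF k(2)] .
    \<comment> \<open>Earlier pieces end no later than \<open>F.hi k\<close>, where both gluings
      leave \<open>h\<close> unchanged.\<close>
    have hi_le: "i \<le> k \<Longrightarrow> 1 \<le> i \<Longrightarrow> F.hi i \<le> F.hi k" for i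
    proof (induction i rule: inc_induct)
      case (step j)
      then have "F.hi j \<le> F.lo (Suc j)" "F.lo (Suc j) < F.hi (Suc j)"
        using k F.hi_le_lo[of j] F.lo_less_hi[of "Suc j"] by auto
      then show ?case using step by simp
    qed simp
    have c1: "compatible L h2 a (F.hi k)"
      by (rule compatible_cong[of _ h]) (use h h1 h2 le in auto)
    have c2: "compatible L h2 (F.hi k) (F.lo (Suc k))"
      by (rule compatible_cong[OF compatible_gap[OF k(2) L(1)[OF k(2)] L(2)[OF k(2)]]])
        (use h1 h2 le in auto)
    have c3: "compatible L h2 (F.lo (Suc k)) (F.hi (Suc k))"
      by (rule compatible_cong[OF piece_comp[OF k(3)]]) (use h2 in auto)
    have "compatible L h2 a (F.lo (Suc k))"
      using compatible_join[OF c1 c2] lo_hi_in_hull[OF k(3)] by simp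
    then have "compatible L h2 a (F.hi (Suc k))"
      using compatible_join[OF _ c3] lo_hi_in_hull[OF k(3)] by simp
    moreover have "h2 (f i y) = s i (g y)" if "i \<in> {1..Suc k}" "y \<in> {a..b}" for i y
    proof (cases "i = Suc k")
      case True
      then show ?thesis using h2(2) F.lo_le[OF k(3) that(2)] piece[OF k(3) that(2)] by simp
    next
      case False
      then have i: "i \<in> {1..k}" using that by auto
      then have "f i y \<le> F.hi i" using F.le_hi[of i y] k that by auto
      then have "f i y \<le> F.hi k" using hi_le[of i] i by auto
      then have "h2 (f i y) = h (f i y)" using h1 h2 le by simp
      then show ?thesis using h i that by auto
    qed
    moreover have "h2 x = gap_map i x" if "i \<in> {1..<Suc k}" "x \<in> {F.hi i..F.lo (Suc i)}" for i x
    proof (cases "i = k")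
      case True
      then show ?thesis using that h1 h2 by simp
    next
      case False
      then have i: "i \<in> {1..<k}" using that by auto
      then have "F.lo (Suc i) < F.hi (Suc i)" "F.hi (Suc i) \<le> F.hi k" 
        using F.lo_less_hi[of "Suc i"] hi_le[of "Suc i"] k by auto
      then have "h2 x = h x" using h1 h2 le that by simp
      then show ?thesis using h i that by auto
    qed
    ultimately show ?case by blast
  qed
  from this[of m] obtain h where h: "compatible L h a b" "refines g h"
    using F.m_pos F.hi_last by (auto simp: refines_def)
  moreover have "h a = A" "h b = B"
    using refined_ends[of 1 g h] refined_ends[of m g h] g h(2) F.m_pos
      F.lo_first F.hi_last G.lo_first G.hi_last by (auto simp: refines_def)
  ultimately show ?thesis by blast
qed

lemma conjugacy_exists:
  obtains g L where "0 < L" "comparable_increments L (\<lambda>x y. y - x) g a b" "g a = A" "g b = B"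
    "\<And>i y. \<lbrakk>i \<in> {1..m}; y \<in> {a..b}\<rbrakk> \<Longrightarrow> g (f i y) = s i (g y)"
proof -
  \<comment> \<open>\<open>k\<close> is the slope of the affine map of \<open>[a,b]\<close> onto
    \<open>[A,B]\<close>, which starts the iteration. Adding up all slopes and reciprocal slopes,
    with 0 for touching pieces, makes \<open>L\<close> dominate every bound required of an affine
    part.\<close>
  define k where "k = (B - A) / (b - a)"
  define \<sigma> where "\<sigma> = (\<Sum>i\<in>{1..<m}. gap_slope i + 1 / gap_slope i)"
  define L where "L = M * (k + 1 / k + \<sigma>)"
  have k0: "0 < k" using F.hull_less G.hull_less by (simp add: k_def)
  have M0: "0 \<le> M" using M_ge_1 by simp
  have term_nonneg: "0 \<le> gap_slope i + 1 / gap_slope i" if "i \<in> {1..<m}" for i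
    using gap_slope_nonneg[OF that] by simp
  then have \<sigma>0: "0 \<le> \<sigma>" unfolding \<sigma>_def by (rule sum_nonneg)
  have Lk: "M * k \<le> L" "M / k \<le> L"
    using mult_left_mono[OF _ M0, of k "k + 1 / k + \<sigma>"] \<sigma>0
      mult_left_mono[OF _ M0, of "1 / k" "k + 1 / k + \<sigma>"] k0 by (auto simp: L_def)
  have L\<sigma>: "M * gap_slope i \<le> L" "M / gap_slope i \<le> L" if i: "i \<in> {1..<m}" for i
  proof -
    have "gap_slope i + 1 / gap_slope i \<le> \<sigma>"
      unfolding \<sigma>_def using i term_nonneg by (intro member_le_sum) auto
    moreover have "0 \<le> 1 / gap_slope i" using gap_slope_nonneg[OF i] by simp
    moreover have "0 \<le> 1 / k" using k0 by simp
    ultimately have "gap_slope i \<le> k + 1 / k + \<sigma>" "1 / gap_slope i \<le> k + 1 / k + \<sigma>"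
      using gap_slope_nonneg[OF i] k0 by linarith+
    then show "M * gap_slope i \<le> L" "M / gap_slope i \<le> L"
      using mult_left_mono[OF _ M0, of "gap_slope i" "k + 1 / k + \<sigma>"]
        mult_left_mono[OF _ M0, of "1 / gap_slope i" "k + 1 / k + \<sigma>"] by (auto simp: L_def)
  qed
  have "\<exists>g. compatible L g a b \<and> g a = A \<and> g b = B"
    using compatible_affine[OF k0 Lk, of a b A a] F.hull_less
    by (intro exI[of _ "\<lambda>x. A + k * (x - a)"]) (simp add: k_def)
  then have "\<exists>G. \<forall>n. (compatible L (G n) a b \<and> G n a = A \<and> G n b = B) \<and> refines (G n) (G (Suc n))"
  proof (rule dependent_nat_choice)
    fix g assume "compatible L g a b \<and> g a = A \<and> g b = B"
    then show "\<exists>h. (compatible L h a b \<and> h a = A \<and> h b = B) \<and> refines g h"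
      using refinement_exists[of L g] L\<sigma> by auto
  qed
  then obtain G where G: "\<And>n. compatible L (G n) a b" "\<And>n. G n a = A" "\<And>n. G n b = B"
    "\<And>n. refines (G n) (G (Suc n))" by blast
  \<comment> \<open>For the empty word \<open>scaled_dist\<close> is the ordinary distance.\<close>
  have incr: "comparable_increments L (\<lambda>x y. y - x) (G n) a b" for n
    using G(1)[of n] by (auto simp: compatible_def comparable_increments_def scaled_dist_def
        dest!: spec[of _ "[]"])
  obtain r where r: "0 \<le> r" "r < 1" "\<And>i. i \<in> {1..m} \<Longrightarrow> \<bar>d i\<bar> \<le> r"
    using uniform_contraction_ratio[of m d] slope_less_1 by blast
  have "0 < M * k" using M_ge_1 k0 by simp
  then have L0: "0 < L" using Lk(1) by linarith
  \<comment> \<open>Consecutive maps first differ by at most \<open>B - A \<le> L * (b - a)\<close>,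
    since their values lie in \<open>[A,B]\<close>. On a piece the difference is then multiplied by
    \<open>\<bar>d i\<bar> \<le> r\<close>, and on a gap all refined maps coincide, so convergence
    is geometric.\<close>
  have step: "\<bar>G (Suc n) x - G n x\<bar> \<le> L * (b - a) * r ^ n" if "x \<in> {a..b}" for n x
    using that
  proof (induction n arbitrary: x)
    case 0
    have "A \<le> G j x \<and> G j x \<le> B" for j
    proof -
      have "x - a \<le> L * (G j x - A)" "b - x \<le> L * (B - G j x)"
        using comparable_incrementsD(2)[OF incr[of j], of a x] 0
          comparable_incrementsD(2)[OF incr[of j], of x b] G(2,3) by auto
      then have "0 \<le> L * (G j x - A)" "0 \<le> L * (B - G j x)" using 0 by auto
      then show ?thesis using L0 by (simp add: zero_le_mult_iff)
    qed
    from this[of 0] this[of 1] have "\<bar>G (Suc 0) x - G 0 x\<bar> \<le> B - A" by auto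
    also have "\<dots> \<le> L * (b - a)"
      using comparable_incrementsD(1)[OF incr[of 0], of a b] F.hull_less G(2,3) by simp
    finally show ?case by simp
  next
    case (Suc n)
    from Suc.prems show ?case
    proof (cases rule: F.hull_cover)
      case (image i y)
      have "G (Suc j) x = s i (G j y)" for j
        using G(4)[of j] image by (simp add: refines_def)
      then have "G (Suc (Suc n)) x - G (Suc n) x = d i * (G (Suc n) y - G n y)"
        by (simp add: affine[OF image(1)] right_diff_distrib)
      then have "\<bar>G (Suc (Suc n)) x - G (Suc n) x\<bar> = \<bar>d i\<bar> * \<bar>G (Suc n) y - G n y\<bar>"
        by (simp only: abs_mult)
      also have "\<dots> \<le> r * (L * (b - a) * r ^ n)"
        using Suc.IH[OF image(2)] r image(1) by (intro mult_mono) auto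
      finally show ?thesis by (simp add: mult_ac)
    next
      case (gap i)
      then have "G (Suc j) x = gap_map i x" for j
        using G(4)[of j] by (simp add: refines_def)
      then show ?thesis using r(1) F.hull_less L0 by simp
    qed
  qed
  define g where "g x = lim (\<lambda>n. G n x)" for x
  have lim: "(\<lambda>n. G n x) \<longlonglongrightarrow> g x" if "x \<in> {a..b}" for x
  proof -
    have "summable (\<lambda>n. L * (b - a) * r ^ n)"
      by (rule summable_mult) (simp add: summable_geometric r)
    then have "summable (\<lambda>n. G (Suc n) x - G n x)"
      by (rule summable_comparison_test') (use step[OF that] in auto)
    then have "(\<lambda>n. \<Sum>i<n. G (Suc i) x - G i x) \<longlonglongrightarrow> (\<Sum>n. G (Suc n) x - G n x)"
      by (rule summable_LIMSEQ)
    then have "(\<lambda>n. G n x - G 0 x) \<longlonglongrightarrow> (\<Sum>n. G (Suc n) x - G n x)"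
      by (simp only: sum_lessThan_telescope[of "\<lambda>n. G n x"])
    then have "(\<lambda>n. G n x - G 0 x + G 0 x) \<longlonglongrightarrow> (\<Sum>n. G (Suc n) x - G n x) + G 0 x"
      by (intro tendsto_intros)
    then have "convergent (\<lambda>n. G n x)" by (auto simp: convergent_def)
    then show ?thesis unfolding g_def by (simp add: convergent_LIMSEQ_iff)
  qed
  show ?thesis
  proof
    show "0 < L" by (rule L0)
    show "comparable_increments L (\<lambda>x y. y - x) g a b"
    proof (rule comparable_incrementsI)
      fix x y assume xy: "a \<le> x" "x \<le> y" "y \<le> b"
      then have l: "(\<lambda>n. G n x) \<longlonglongrightarrow> g x" "(\<lambda>n. G n y) \<longlonglongrightarrow> g y" by (auto intro: lim)
      show "g y - g x \<le> L * (y - x)"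
        using comparable_incrementsD(1)[OF incr xy]
        by (intro LIMSEQ_le_const2[OF tendsto_diff[OF l(2,1)]]) auto
      show "y - x \<le> L * (g y - g x)"
        using comparable_incrementsD(2)[OF incr xy]
        by (intro LIMSEQ_le_const[OF tendsto_mult_left[OF tendsto_diff[OF l(2,1)]]]) auto
    qed
    show "g a = A" "g b = B" by (simp_all add: g_def G(2,3))
    fix i y assume i: "i \<in> {1..m}" and y: "y \<in> {a..b}"
    have "(\<lambda>n. G (Suc n) (f i y)) \<longlonglongrightarrow> g (f i y)"
      using lim[OF F.maps_hull[OF i y]] by (rule LIMSEQ_Suc)
    moreover have "G (Suc n) (f i y) = c i + d i * G n y" for n
      using G(4)[of n] i y by (simp add: refines_def affine)
    moreover have "(\<lambda>n. c i + d i * G n y) \<longlonglongrightarrow> c i + d i * g y"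
      using lim[OF y] by (intro tendsto_intros)
    ultimately show "g (f i y) = s i (g y)"
      using LIMSEQ_unique by (simp add: affine[OF i]) blast
  qed
qed

end

section \<open>The hull of the support of a generated measure\<close>

lemma emeasure_Union_null:
  assumes "countable C" "\<And>U. U \<in> C \<Longrightarrow> U \<in> sets M" "\<And>U. U \<in> C \<Longrightarrow> emeasure M U = 0"
  shows "emeasure M (\<Union>C) = 0"
proof -
  have "\<Union>C \<in> null_sets M"
    using assms null_sets_UN'[of C "\<lambda>U. U" M] by (auto simp: null_sets_def)
  then show ?thesis by auto
qed

text \<open>Common setting of the conformal and the affine system, so that the study of the support
  serves both.\<close>

locale interval_ifs =
  fixes m :: nat and f :: "nat \<Rightarrow> real \<Rightarrow> real" and \<rho> :: "nat \<Rightarrow> real" and \<mu> :: "real measure"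
  assumes two_maps: "2 \<le> m"
    and cont: "i \<in> {1..m} \<Longrightarrow> continuous_on {0..1} (f i)"
    and inj: "i \<in> {1..m} \<Longrightarrow> inj_on (f i) {0..1}"
    and maps01: "\<lbrakk>i \<in> {1..m}; y \<in> {0..1}\<rbrakk> \<Longrightarrow> f i y \<in> {0..1}"
    and asc: "ascending m f"
    and weight_pos: "i \<in> {1..m} \<Longrightarrow> 0 < \<rho> i"
    and generated: "generated_measure m f \<rho> \<mu>"
begin

lemma space_\<mu>: "space \<mu> = {0..1}"
  and sets_\<mu>: "sets \<mu> = sets (restrict_space borel {0..1})"
  and total_mass: "emeasure \<mu> {0..1} = 1"
  and self_similar: "E \<in> sets \<mu> \<Longrightarrow>
      emeasure \<mu> E = (\<Sum>i=1..m. ennreal (\<rho> i) * emeasure \<mu> (f i -` E \<inter> {0..1}))"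
  using generated by (simp_all add: generated_measure_def)

lemma sets_\<mu>_iff: "E \<in> sets \<mu> \<longleftrightarrow> E \<in> sets borel \<and> E \<subseteq> {0..1}"
  by (simp add: sets_\<mu> sets_restrict_space_iff Int_absorb1 conj_commute)

lemma vimage_measurable:
  assumes "i \<in> {1..m}" "E \<in> sets \<mu>" shows "f i -` E \<inter> {0..1} \<in> sets \<mu>"
proof -
  have "f i \<in> measurable (restrict_space borel {0..1}) borel"
    using cont[OF assms(1)] by (rule borel_measurable_continuous_on_restrict)
  then have "f i \<in> measurable \<mu> borel"
    by (subst measurable_cong_sets[OF sets_\<mu> refl])
  then show ?thesis using assms(2) sets_\<mu>_iff measurable_sets[of "f i" \<mu> borel E] space_\<mu> by auto
qed

text \<open>The restriction to \<open>{1..m}\<close> makes the predicates of two systems with the same structure equal.\<close>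

definition up :: "nat \<Rightarrow> bool" where "up i \<longleftrightarrow> i \<in> {1..m} \<and> \<not> changes_orientation (f i)"

text \<open>A continuous injective map of an interval is strictly monotone, so not being decreasing
  means being increasing.\<close>

lemma increasing: "\<lbrakk>i \<in> {1..m}; up i\<rbrakk> \<Longrightarrow> strict_mono_on {0..1} (f i)"
  using injective_eq_monotone_map[of "{0..1}" "f i"] cont inj by (auto simp: up_def is_interval_cc)

lemma decreasing: "\<lbrakk>i \<in> {1..m}; \<not> up i\<rbrakk> \<Longrightarrow> strict_antimono_on {0..1} (f i)"
  by (simp add: up_def)

lemma ascending_less:
  assumes "1 \<le> i" "i < j" "j \<le> m" "x \<in> {0..1}" "y \<in> {0..1}"
  shows "f i x \<le> f j y"
  using assms(2,3,5)
proof (induction j arbitrary: y)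
  case (Suc j)
  have s: "f j z \<le> f (Suc j) y" if "z \<in> {0..1}" for z
    using asc Suc.prems assms(1) that by (auto simp: ascending_def)
  show ?case
  proof (cases "i = j")
    case True
    then show ?thesis using s assms by simp
  next
    case False
    then have "f i x \<le> f j 0" using Suc by simp
    then show ?thesis using s[of 0] by simp
  qed
qed simp

section \<open>The support as a closed self-similar set\<close>

abbreviation K :: "real set" where "K \<equiv> measure_support \<mu>"

lemma K_iff:
  "x \<in> K \<longleftrightarrow> x \<in> {0..1} \<and> (\<forall>U. open U \<longrightarrow> x \<in> U \<longrightarrow> emeasure \<mu> (U \<inter> {0..1}) > 0)"
  by (auto simp: measure_support_def space_\<mu>)

lemma open_Int_sets: "open U \<Longrightarrow> U \<inter> {0..1} \<in> sets \<mu>"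
  by (simp add: sets_\<mu>_iff)

lemma closed_K: "closed K"
proof -
  have "x \<notin> K \<Longrightarrow> \<exists>T. open T \<and> x \<in> T \<and> T \<subseteq> - K" for x
  proof (cases "x \<in> {0..1}")
    case True
    assume "x \<notin> K"
    then obtain U where "open U" "x \<in> U" "emeasure \<mu> (U \<inter> {0..1}) = 0"
      using True by (auto simp: K_iff zero_less_iff_neq_zero)
    then show ?thesis by (intro exI[of _ U]) (auto simp: K_iff dest!: spec[of _ U])
  next
    case False
    then show ?thesis by (intro exI[of _ "- {0..1}"]) (auto simp: K_iff open_Compl)
  qed
  then have "open (- K)" by (subst open_subopen) blast
  then show ?thesis by (simp add: closed_def)
qed

lemma K_subset: "K \<subseteq> {0..1}" by (auto simp: K_iff)

lemma K_sets: "K \<in> sets \<mu>" using K_subset closed_K by (simp add: sets_\<mu>_iff)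

text \<open>The complement of the support is a union of open null sets; by Lindelof countably many
  of them suffice.\<close>

lemma null_outside_K: "emeasure \<mu> ({0..1} - K) = 0"
proof -
  define \<F> where "\<F> = {U. open U \<and> emeasure \<mu> (U \<inter> {0..1}) = 0}"
  obtain \<F>' where F': "\<F>' \<subseteq> \<F>" "countable \<F>'" "\<Union>\<F>' = \<Union>\<F>"
    using Lindelof[of \<F>] by (auto simp: \<F>_def)
  have eq: "{0..1} - K = (\<Union>U\<in>\<F>'. U \<inter> {0..1})"
  proof -
    have "{0..1} - K = \<Union>\<F> \<inter> {0..1}" by (auto simp: K_iff \<F>_def zero_less_iff_neq_zero)
    then show ?thesis using F'(3) by auto
  qed
  have "emeasure \<mu> (\<Union>((\<lambda>U. U \<inter> {0..1}) ` \<F>')) = 0"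
    using F'(1,2) by (intro emeasure_Union_null) (auto simp: \<F>_def open_Int_sets)
  then show ?thesis by (simp add: eq)
qed

lemma null_if_disjoint_K:
  assumes "E \<in> sets \<mu>" "E \<inter> K = {}"
  shows "emeasure \<mu> E = 0"
proof -
  have "emeasure \<mu> E \<le> emeasure \<mu> ({0..1} - K)"
    using assms K_sets sets_\<mu>_iff by (intro emeasure_mono) auto
  then show ?thesis by (simp add: null_outside_K)
qed

lemma emeasure_cong_K:
  assumes "E \<in> sets \<mu>" "F \<in> sets \<mu>" "E \<inter> K = F \<inter> K"
  shows "emeasure \<mu> E = emeasure \<mu> F"
proof -
  have "emeasure \<mu> E = emeasure \<mu> (E \<inter> K)" if "E \<in> sets \<mu>" for E
  proof -
    have "emeasure \<mu> E = emeasure \<mu> (E \<inter> K) + emeasure \<mu> (E - K)"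
      using that K_sets by (subst plus_emeasure) (auto simp: Int_Diff_Un)
    also have "emeasure \<mu> (E - K) = 0" using that K_sets by (intro null_if_disjoint_K) auto
    finally show ?thesis by simp
  qed
  then show ?thesis using assms by metis
qed

lemma K_nonempty: "K \<noteq> {}"
  using null_outside_K total_mass by auto

text \<open>A neighbourhood of \<open>f i x\<close> pulls back to a neighbourhood of
  \<open>x\<close>, which has positive mass, and this already makes the \<open>i\<close>-th term of
  the self-similarity equation positive.\<close>

lemma image_K_subset:
  assumes i: "i \<in> {1..m}" and x: "x \<in> K"
  shows "f i x \<in> K"
  unfolding K_iff
proof (intro conjI allI impI)
  have x01: "x \<in> {0..1}" using x K_subset by auto
  then show "f i x \<in> {0..1}" using maps01 i by blast
  fix U :: "real set" assume U: "open U" "f i x \<in> U"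
  obtain V where V: "open V" "V \<inter> {0..1} = f i -` U \<inter> {0..1}"
    using cont[OF i] U(1) unfolding continuous_on_open_invariant by blast
  have "f i -` (U \<inter> {0..1}) \<inter> {0..1} = V \<inter> {0..1}" using V maps01[OF i] by blast
  moreover have "x \<in> V" using V U x01 by blast
  then have "emeasure \<mu> (V \<inter> {0..1}) > 0" using x V(1) by (simp add: K_iff)
  ultimately have "0 < ennreal (\<rho> i) * emeasure \<mu> (f i -` (U \<inter> {0..1}) \<inter> {0..1})"
    using weight_pos[OF i] by (simp add: ennreal_zero_less_mult_iff)
  also have "\<dots> \<le> emeasure \<mu> (U \<inter> {0..1})"
    unfolding self_similar[OF open_Int_sets[OF U(1)]] using i by (intro member_le_sum) auto
  finally show "0 < emeasure \<mu> (U \<inter> {0..1})" .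
qed

text \<open>The images of the compact support have a closed union. Its open complement pulls back
  under every map to a set missing the support, hence is null and contains no point of the
  support.\<close>

lemma K_covered:
  assumes "x \<in> K" obtains i y where "i \<in> {1..m}" "y \<in> K" "x = f i y"
proof (rule ccontr)
  assume "\<not> thesis"
  then have x: "x \<notin> (\<Union>i\<in>{1..m}. f i ` K)" using that by blast
  have "compact K"
    using compact_Int_closed[OF compact_Icc closed_K, of 0 1] K_subset by (simp add: Int_absorb1)
  then have "closed (f i ` K)" if "i \<in> {1..m}" for i
    using continuous_on_subset[OF cont[OF that] K_subset]
    by (intro compact_imp_closed compact_continuous_image)
  then have "closed (\<Union>i\<in>{1..m}. f i ` K)" by (intro closed_UN) auto
  then have U: "open (- (\<Union>i\<in>{1..m}. f i ` K))" (is "open ?U") by (rule open_Compl)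
  have "emeasure \<mu> (f i -` (?U \<inter> {0..1}) \<inter> {0..1}) = 0" if "i \<in> {1..m}" for i
    using vimage_measurable[OF that open_Int_sets[OF U]] that by (intro null_if_disjoint_K) auto
  then have "emeasure \<mu> (?U \<inter> {0..1}) = 0"
    using self_similar[OF open_Int_sets[OF U]] by (simp add: sum.neutral)
  moreover have "emeasure \<mu> (?U \<inter> {0..1}) > 0"
    using assms U x by (simp only: K_iff) blast
  ultimately show False by simp
qed

section \<open>The convex hull of the support\<close>

definition a :: real where "a = Inf K"
definition b :: real where "b = Sup K"

lemma bdd_K: "bdd_below K" "bdd_above K"
  using bdd_below_mono[OF bdd_below_Icc K_subset] bdd_above_mono[OF bdd_above_Icc K_subset] by auto

lemma a_in_K: "a \<in> K" and b_in_K: "b \<in> K"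
  unfolding a_def b_def using closed_contains_Inf[OF K_nonempty bdd_K(1) closed_K]
    closed_contains_Sup[OF K_nonempty bdd_K(2) closed_K] by auto

lemma K_hull: "x \<in> K \<Longrightarrow> a \<le> x \<and> x \<le> b"
  unfolding a_def b_def using cInf_lower[OF _ bdd_K(1)] cSup_upper[OF _ bdd_K(2)] by blast

lemma hull_subset: "{a..b} \<subseteq> {0..1}"
  using a_in_K b_in_K K_subset by auto

lemma a_eq_0_iff: "a = 0 \<longleftrightarrow> 0 \<in> K" and b_eq_1_iff: "b = 1 \<longleftrightarrow> 1 \<in> K"
  using a_in_K b_in_K K_hull[of 0] K_hull[of 1] K_subset
  by (metis antisym atLeastAtMost_iff subsetD)+

text \<open>If the support were the single point \<open>a\<close>, both \<open>f 1\<close> and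
  \<open>f 2\<close> would fix it, and the ordering would give \<open>f 1 \<le> a \<le> f 2\<close>
  on \<open>[0,1]\<close>. Then \<open>f 1\<close> has an interior maximum at \<open>a\<close>, or
  \<open>f 1\<close> is 0 at both ends (if \<open>a = 0\<close>), or \<open>f 2\<close> is 1 at both
  ends (if \<open>a = 1\<close>). Each contradicts injectivity.\<close>

lemma a_less_b: "a < b"
proof (rule ccontr)
  assume "\<not> a < b"
  then have ba: "b = a" using a_in_K K_hull by fastforce
  have i: "1 \<in> {1..m}" "2 \<in> {1..m}" using two_maps by auto
  have fa: "f 1 a = a" "f 2 a = a" using image_K_subset[OF i(1) a_in_K] image_K_subset[OF i(2) a_in_K]
      K_hull ba by fastforce+
  have a01: "a \<in> {0..1}" using a_in_K K_subset by auto
  have le: "f 1 y \<le> a" "a \<le> f 2 y" if "y \<in> {0..1}" for y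
    using ascending_less[of 1 2 y a] ascending_less[of 1 2 a y] two_maps fa a01 that by auto
  have *: "f 1 0 \<noteq> f 1 1" "f 2 0 \<noteq> f 2 1" 
    using inj_on_eq_iff[OF inj[OF i(1)], of 0 1] inj_on_eq_iff[OF inj[OF i(2)], of 0 1] by simp_all
  consider "a = 0" | "a = 1" | "0 < a" "a < 1" using a01 unfolding atLeastAtMost_iff le_less by metis
  then show False
  proof cases
    case 1
    then show False using le(1)[of 0] le(1)[of 1] maps01[OF i(1), of 0] maps01[OF i(1), of 1] * by simp
  next
    case 2
    then show False using le(2)[of 0] le(2)[of 1] maps01[OF i(2), of 0] maps01[OF i(2), of 1] * by simp
  next
    case 3
    have "f 1 0 \<le> f 1 a" "f 1 1 \<le> f 1 a" using le(1)[of 0] le(1)[of 1] fa(1) by simp_all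
    then show False
      using continuous_inj_imp_mono[OF 3 cont[OF i(1)] inj[OF i(1)]] by linarith
  qed
qed

text \<open>The endpoints of the hull lie in the support, so their images do too; monotonicity keeps
  all other images between these.\<close>

sublocale tight_hull_system m f up a b
proof -
  have ends: "f i a \<in> {a..b}" "f i b \<in> {a..b}" if "i \<in> {1..m}" for i
    using image_K_subset[OF that a_in_K] image_K_subset[OF that b_in_K] K_hull by auto
  have "hull_system m f up a b"
  proof
    show "1 \<le> m" using two_maps by simp
    show "a < b" by (rule a_less_b)
    fix i assume i: "i \<in> {1..m}"
    show "continuous_on {a..b} (f i)" using cont[OF i] hull_subset continuous_on_subset by blast
    show inc: "strict_mono_on {a..b} (f i)" if "up i"
      using increasing[OF i that] hull_subset monotone_on_subset by blast
    show dec: "strict_antimono_on {a..b} (f i)" if "\<not> up i"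
      using decreasing[OF i that] hull_subset monotone_on_subset by blast
    fix y assume y: "y \<in> {a..b}"
    show "f i y \<in> {a..b}"
    proof (cases "up i")
      case True
      then have "mono_on {a..b} (f i)" using inc strict_mono_on_imp_mono_on by blast
      then have "f i a \<le> f i y" "f i y \<le> f i b" using y by (auto simp: monotone_on_def)
      then show ?thesis using ends[OF i] by auto
    next
      case False
      then have "antimono_on {a..b} (f i)" using dec by (simp add: strict_antimono_iff_antimono)
      then have "f i b \<le> f i y" "f i y \<le> f i a" using y by (auto simp: monotone_on_def)
      then show ?thesis using ends[OF i] by auto
    qed
  qed
  then interpret hull_system m f up a b .
  have ab: "a \<in> {0..1}" "b \<in> {0..1}" using a_in_K b_in_K K_subset by auto
  have lo_K: "lo i \<in> K" "hi i \<in> K" if "i \<in> {1..m}" for i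
    using image_K_subset[OF that] a_in_K b_in_K by (auto simp: lo_def hi_def)
  have lo_mono: "lo i \<le> lo j" "hi i \<le> hi j" if "1 \<le> i" "i \<le> j" "j \<le> m" for i j
    using ascending_less[of i j] ab that by (cases "i = j"; auto simp: lo_def hi_def)+
  have m: "1 \<in> {1..m}" "m \<in> {1..m}" using two_maps by auto
  show "tight_hull_system m f up a b"
  proof
    \<comment> \<open>The support point \<open>a\<close> lies in some piece \<open>i\<close>, which
      gives \<open>lo i \<le> a\<close>, and the first piece has the smallest \<open>lo\<close>. The
      argument at \<open>b\<close> is symmetric.\<close>
    obtain i y where *: "i \<in> {1..m}" "y \<in> K" "a = f i y" using K_covered[OF a_in_K] .
    then have "lo 1 \<le> lo i" "lo i \<le> a" using lo_mono(1)[of 1 i] lo_le[of i y] K_hull by auto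
    then show "lo 1 = a" using K_hull[OF lo_K(1)[OF m(1)]] by simp
    obtain i y where *: "i \<in> {1..m}" "y \<in> K" "b = f i y" using K_covered[OF b_in_K] .
    then have "b \<le> hi i" "hi i \<le> hi m" using lo_mono(2)[of i m] le_hi[of i y] K_hull by auto
    then show "hi m = b" using K_hull[OF lo_K(2)[OF m(2)]] by simp
    show "hi i \<le> lo (Suc i)" if "i \<in> {1..<m}" for i
      using ascending_less[of i "Suc i"] ab that by (simp add: lo_def hi_def)
  qed
qed

text \<open>The extreme values of a monotone map are attained only at \<open>0\<close> and \<open>1\<close>, so the hulls of
  neighbouring pieces can meet only if the hull of the support reaches those endpoints.\<close>

lemma hulls_touch_iff:
  assumes i: "i \<in> {1..<m}"
  shows "hi i = lo (Suc i) \<longleftrightarrow>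
    f i ` {0..1} \<inter> f (Suc i) ` {0..1} \<noteq> {} \<and>
    (if up i then b = 1 else a = 0) \<and> (if up (Suc i) then a = 0 else b = 1)"
proof -
  have ii: "i \<in> {1..m}" "Suc i \<in> {1..m}" using i by auto
  have ab: "a \<in> {0..1}" "b \<in> {0..1}" using a_in_K b_in_K K_subset by auto
  have asc: "f i x \<le> f (Suc i) y" if "x \<in> {0..1}" "y \<in> {0..1}" for x y
    using ascending_less[of i "Suc i"] that i by simp
  show ?thesis
  proof
    assume eq: "hi i = lo (Suc i)"
    \<comment> \<open>If the hulls touch, the ordering with the neighbouring map makes
      \<open>hi i\<close> the maximum of \<open>f i\<close> over all of \<open>[0,1]\<close>, not
      only over the hull.\<close>
    have max: "f i x \<le> hi i" if "x \<in> {0..1}" for x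
      using asc[OF that, of "if up (Suc i) then a else b"] ab eq by (simp add: lo_def split: if_splits)
    have min: "lo (Suc i) \<le> f (Suc i) x" if "x \<in> {0..1}" for x
      using asc[of "if up i then b else a", OF _ that] ab eq by (simp add: hi_def split: if_splits)
    have "hi i \<in> f i ` {0..1}" "lo (Suc i) \<in> f (Suc i) ` {0..1}"
      using ab by (auto simp: lo_def hi_def)
    moreover have "if up i then b = 1 else a = 0"
    proof (cases "up i")
      case True
      then show ?thesis using strict_mono_onD[OF increasing[OF ii(1) True], of b 1] max[of 1] ab
        by (auto simp: hi_def le_less)
    next
      case False
      then show ?thesis using monotone_onD[OF decreasing[OF ii(1) False], of 0 a] max[of 0] ab
        by (auto simp: hi_def le_less)
    qed
    moreover have "if up (Suc i) then a = 0 else b = 1"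
    proof (cases "up (Suc i)")
      case True
      then show ?thesis using strict_mono_onD[OF increasing[OF ii(2) True], of 0 a] min[of 0] ab
        by (auto simp: lo_def le_less)
    next
      case False
      then show ?thesis using monotone_onD[OF decreasing[OF ii(2) False], of b 1] min[of 1] ab
        by (auto simp: lo_def le_less)
    qed
    ultimately show "f i ` {0..1} \<inter> f (Suc i) ` {0..1} \<noteq> {} \<and>
      (if up i then b = 1 else a = 0) \<and> (if up (Suc i) then a = 0 else b = 1)"
      using eq by auto
  next
    assume *: "f i ` {0..1} \<inter> f (Suc i) ` {0..1} \<noteq> {} \<and>
      (if up i then b = 1 else a = 0) \<and> (if up (Suc i) then a = 0 else b = 1)"
    then obtain x y where xy: "x \<in> {0..1}" "y \<in> {0..1}" "f i x = f (Suc i) y" by blast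
    \<comment> \<open>By the endpoint conditions \<open>hi i\<close> is the value of
      \<open>f i\<close> at the end of \<open>[0,1]\<close> where it is largest, and dually for
      \<open>lo (Suc i)\<close>. A common value of the two maps then forces
      \<open>lo (Suc i) \<le> hi i\<close>.\<close>
    have "f i x \<le> hi i"
    proof (cases "up i")
      case True
      then have "mono_on {0..1} (f i)" using increasing[OF ii(1)] strict_mono_on_imp_mono_on by blast
      then have "f i x \<le> f i 1" using monotone_onD[of _ _ _ "f i" x 1] xy(1) by fastforce
      then show ?thesis using * unfolding hi_def by (simp add: True)
    next
      case False
      then have "antimono_on {0..1} (f i)" using decreasing[OF ii(1)] by (simp add: strict_antimono_iff_antimono)
      then have "f i x \<le> f i 0" using monotone_onD[of _ _ _ "f i" 0 x] xy(1) by fastforce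
      then show ?thesis using * unfolding hi_def by (simp add: False)
    qed
    moreover have "lo (Suc i) \<le> f (Suc i) y"
    proof (cases "up (Suc i)")
      case True
      then have "mono_on {0..1} (f (Suc i))"
        using increasing[OF ii(2)] strict_mono_on_imp_mono_on by blast
      then have "f (Suc i) 0 \<le> f (Suc i) y"
        using monotone_onD[of _ _ _ "f (Suc i)" 0 y] xy(2) by fastforce
      then show ?thesis using * unfolding lo_def by (simp add: True)
    next
      case False
      then have "antimono_on {0..1} (f (Suc i))"
        using decreasing[OF ii(2)] by (simp add: strict_antimono_iff_antimono)
      then have "f (Suc i) 1 \<le> f (Suc i) y"
        using monotone_onD[of _ _ _ "f (Suc i)" y 1] xy(2) by fastforce
      then show ?thesis using * unfolding lo_def by (simp add: False)
    qed
    ultimately show "hi i = lo (Suc i)" using xy hi_le_lo[OF i] by simp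
  qed
qed

end

section \<open>Bounded distortion\<close>

lemma prod_list_mset_eq:
  "mset v = mset w \<Longrightarrow> prod_list (map g v) = (prod_list (map g w) :: 'a::comm_monoid_mult)"
  by (metis mset_map prod_mset_prod_list)

lemma has_deriv01:
  assumes "f differentiable (at y within {0..1})"
  shows "(f has_real_derivative deriv01 f y) (at y within {0..1})"
  using assms by (simp add: has_real_derivative_iff_has_vector_derivative vector_derivative_works[symmetric])

lemma deriv01_unique:
  assumes "(f has_real_derivative D) (at y within {0..1})" "y \<in> {0..1}"
  shows "deriv01 f y = D"
  using assms vector_derivative_within_closed_interval[of 0 1 y f D]
  by (simp add: has_real_derivative_iff_has_vector_derivative)

locale distorted_ifs =
  fixes m :: nat and \<phi> :: "nat \<Rightarrow> real \<Rightarrow> real" and x :: "nat \<Rightarrow> real" and C :: real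
  assumes differentiable: "\<lbrakk>i \<in> {1..m}; y \<in> {0..1}\<rbrakk> \<Longrightarrow> \<phi> i differentiable (at y within {0..1})"
    and into: "\<lbrakk>i \<in> {1..m}; y \<in> {0..1}\<rbrakk> \<Longrightarrow> \<phi> i y \<in> {0..1}"
    and deriv_nonzero: "\<lbrakk>i \<in> {1..m}; y \<in> {0..1}\<rbrakk> \<Longrightarrow> deriv01 (\<phi> i) y \<noteq> 0"
    and fixed_point: "i \<in> {1..m} \<Longrightarrow> x i \<in> {0..1} \<and> \<phi> i (x i) = x i"
    and C_ge_1: "1 \<le> C"
    and distort: "\<lbrakk>set w \<subseteq> {1..m}; \<sigma> permutes {..<length w}; y \<in> {0..1}; z \<in> {0..1}\<rbrakk> \<Longrightarrow>
      \<bar>deriv01 (word_map \<phi> w) y / deriv01 (word_map \<phi> (permute_list \<sigma> w)) z\<bar> \<le> C"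
begin

abbreviation multiplier :: "nat \<Rightarrow> real" where "multiplier i \<equiv> deriv01 (\<phi> i) (x i)"

lemma word_map_into: "\<lbrakk>set w \<subseteq> {1..m}; y \<in> {0..1}\<rbrakk> \<Longrightarrow> word_map \<phi> w y \<in> {0..1}"
proof (induction w)
  case (Cons i w)
  then show ?case using into[of i "word_map \<phi> w y"] by simp
qed simp

lemma word_map_derivative_Cons:
  assumes "set (i # w) \<subseteq> {1..m}" "y \<in> {0..1}"
    and "(word_map \<phi> w has_real_derivative D) (at y within {0..1})"
  shows "(word_map \<phi> (i # w) has_real_derivative deriv01 (\<phi> i) (word_map \<phi> w y) * D)
    (at y within {0..1})"
proof -
  have "word_map \<phi> w y \<in> {0..1}" using word_map_into assms(1,2) by simp
  then have "(\<phi> i has_real_derivative deriv01 (\<phi> i) (word_map \<phi> w y))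
      (at (word_map \<phi> w y) within {0..1})"
    using assms(1) differentiable by (intro has_deriv01) simp
  moreover have "word_map \<phi> w ` {0..1} \<subseteq> {0..1}" using word_map_into assms(1) by auto
  ultimately show ?thesis
    using DERIV_image_chain[OF DERIV_subset assms(3)] by (simp add: o_def)
qed

lemma word_map_derivative:
  assumes "set w \<subseteq> {1..m}" "y \<in> {0..1}"
  shows "(word_map \<phi> w has_real_derivative deriv01 (word_map \<phi> w) y) (at y within {0..1})"
proof -
  have "\<exists>D. (word_map \<phi> w has_real_derivative D) (at y within {0..1})"
    using assms(1)
  proof (induction w)
    case Nil
    then show ?case by (auto intro: DERIV_ident)
  next
    case (Cons i w)
    then show ?case using word_map_derivative_Cons[OF Cons.prems assms(2)] by auto
  qed
  then show ?thesis using deriv01_unique assms(2) by metis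
qed

lemma deriv01_Nil: "y \<in> {0..1} \<Longrightarrow> deriv01 (\<lambda>y. y) y = 1"
  by (rule deriv01_unique) (auto intro: DERIV_ident)

lemma deriv01_Cons:
  assumes "set (i # w) \<subseteq> {1..m}" "y \<in> {0..1}"
  shows "deriv01 (word_map \<phi> (i # w)) y =
    deriv01 (\<phi> i) (word_map \<phi> w y) * deriv01 (word_map \<phi> w) y"
  using word_map_derivative_Cons[OF assms word_map_derivative] assms
  by (intro deriv01_unique) auto

lemma deriv01_append:
  assumes "set (v @ w) \<subseteq> {1..m}" "y \<in> {0..1}"
  shows "deriv01 (word_map \<phi> (v @ w)) y =
    deriv01 (word_map \<phi> v) (word_map \<phi> w y) * deriv01 (word_map \<phi> w) y"
  using assms(1)
proof (induction v)
  case Nil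
  then show ?case using deriv01_Nil[OF word_map_into[OF _ assms(2), of w]] by simp
next
  case (Cons i v)
  have "deriv01 (word_map \<phi> (i # v @ w)) y =
      deriv01 (\<phi> i) (word_map \<phi> (v @ w) y) * deriv01 (word_map \<phi> (v @ w)) y"
    using deriv01_Cons[of i "v @ w" y] Cons.prems assms(2) by simp
  also have "\<dots> = deriv01 (\<phi> i) (word_map \<phi> v (word_map \<phi> w y)) *
      (deriv01 (word_map \<phi> v) (word_map \<phi> w y) * deriv01 (word_map \<phi> w) y)"
    using Cons by simp
  also have "\<dots> = deriv01 (word_map \<phi> (i # v)) (word_map \<phi> w y) * deriv01 (word_map \<phi> w) y"
    using deriv01_Cons[of i v "word_map \<phi> w y"] word_map_into[OF _ assms(2), of w] Cons.prems by simp
  finally show ?case by (simp only: append_Cons)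
qed

lemma deriv01_word_nonzero:
  "\<lbrakk>set w \<subseteq> {1..m}; y \<in> {0..1}\<rbrakk> \<Longrightarrow> deriv01 (word_map \<phi> w) y \<noteq> 0"
proof (induction w)
  case Nil
  then show ?case using deriv01_Nil by simp
next
  case (Cons i w)
  then have "deriv01 (\<phi> i) (word_map \<phi> w y) \<noteq> 0"
    using deriv_nonzero[of i "word_map \<phi> w y"] word_map_into[of w y] by simp
  then show ?case using Cons deriv01_Cons[of i w y] by simp
qed

text \<open>At the fixed point every factor of the chain rule is the same multiplier.\<close>

lemma deriv01_power_at_fixed_point:
  assumes "i \<in> {1..m}"
  shows "word_map \<phi> (replicate k i) (x i) = x i"
    "deriv01 (word_map \<phi> (replicate k i)) (x i) = multiplier i ^ k"
proof -
  show *: "word_map \<phi> (replicate k i) (x i) = x i" for k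
    by (induction k) (use fixed_point[OF assms] in auto)
  have s: "set (replicate k i) \<subseteq> {1..m}" for k using assms by (induction k) auto
  show "deriv01 (word_map \<phi> (replicate k i)) (x i) = multiplier i ^ k"
  proof (induction k)
    case 0
    then show ?case using deriv01_Nil fixed_point[OF assms] by simp
  next
    case (Suc k)
    have "deriv01 (word_map \<phi> (i # replicate k i)) (x i) =
        multiplier i * deriv01 (word_map \<phi> (replicate k i)) (x i)"
      using deriv01_Cons[of i "replicate k i" "x i"] s[of "Suc k"] fixed_point[OF assms] *[of k]
      by simp
    then show ?case using Suc by (simp only: replicate_Suc power_Suc)
  qed
qed

text \<open>Words with equal multisets are permutations of each other. The hypothesis is symmetric
  in \<open>v\<close> and \<open>w\<close>, so exchanging them gives the reverse estimate.\<close>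

lemma deriv01_rearrange:
  assumes "mset v = mset w" "set w \<subseteq> {1..m}" "y \<in> {0..1}" "z \<in> {0..1}"
  shows "\<bar>deriv01 (word_map \<phi> w) y\<bar> \<le> C * \<bar>deriv01 (word_map \<phi> v) z\<bar>"
proof -
  obtain p where p: "p permutes {..<length w}" "permute_list p w = v"
    using mset_eq_permutation[OF assms(1)] .
  have v: "set v \<subseteq> {1..m}" using mset_eq_setD[OF assms(1)] assms(2) by simp
  have "\<bar>deriv01 (word_map \<phi> w) y / deriv01 (word_map \<phi> v) z\<bar> \<le> C"
    using distort[OF assms(2) p(1) assms(3,4)] p(2) by simp
  then show ?thesis using deriv01_word_nonzero[OF v assms(4)] 
    by (simp add: abs_divide divide_le_eq)
qed

text \<open>Induction on the alphabet size. Collecting all copies of the largest letter at the end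
  of the word costs a factor \<open>C\<close>, and comparing that block with its derivative at the
  fixed point costs another, so each letter contributes \<open>C ^ 2\<close> however long the word
  is.\<close>

lemma deriv01_comparable_multipliers:
  assumes "n \<le> m" "set w \<subseteq> {1..n}" "y \<in> {0..1}"
  shows "\<bar>deriv01 (word_map \<phi> w) y\<bar> \<le> C ^ (2 * n) * \<bar>prod_list (map multiplier w)\<bar> \<and>
    \<bar>prod_list (map multiplier w)\<bar> \<le> C ^ (2 * n) * \<bar>deriv01 (word_map \<phi> w) y\<bar>"
  using assms
proof (induction n arbitrary: w y)
  case 0
  then show ?case using deriv01_Nil by simp
next
  case (Suc n)
  \<comment> \<open>In \<open>v @ u\<close> the block \<open>u\<close> of equal letters acts first,
    so \<open>u\<close> is differentiated at \<open>y\<close> and \<open>v\<close> at the image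
    \<open>?z\<close>, where the induction hypothesis applies.\<close>
  define v where "v = filter (\<lambda>i. i \<noteq> Suc n) w"
  define u where "u = filter (\<lambda>i. i = Suc n) w"
  define k where "k = length u"
  have u: "u = replicate k (Suc n)"
    unfolding k_def by (rule replicate_length_same[symmetric]) (simp add: u_def)
  have ms: "mset (v @ u) = mset w" by (simp add: u_def v_def)
  have i: "Suc n \<in> {1..m}" using Suc.prems by simp
  have v_sub: "set v \<subseteq> {1..n}" using Suc.prems(2) by (force simp: v_def)
  have w_sub: "set w \<subseteq> {1..m}" using Suc.prems by force
  have vu_sub: "set (v @ u) \<subseteq> {1..m}" using mset_eq_setD[OF ms] w_sub by simp
  then have u_sub: "set u \<subseteq> {1..m}" by simp
  let ?z = "word_map \<phi> u y" and ?E = "C ^ (2 * n)"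
  have z: "?z \<in> {0..1}" using word_map_into u_sub Suc.prems(3) by blast
  let ?Dv = "\<bar>deriv01 (word_map \<phi> v) ?z\<bar>" and ?Du = "\<bar>deriv01 (word_map \<phi> u) y\<bar>"
    and ?Pv = "\<bar>prod_list (map multiplier v)\<bar>" and ?Pu = "\<bar>multiplier (Suc n)\<bar> ^ k"
  let ?Dw = "\<bar>deriv01 (word_map \<phi> w) y\<bar>"
  have Pw: "\<bar>prod_list (map multiplier w)\<bar> = ?Pv * ?Pu"
    using prod_list_mset_eq[OF ms, of multiplier]
    by (simp add: u abs_mult[symmetric] power_abs[symmetric])
  have Dvu: "\<bar>deriv01 (word_map \<phi> (v @ u)) y\<bar> = ?Dv * ?Du"
    using deriv01_append[OF vu_sub Suc.prems(3)] by (simp add: abs_mult)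
  have v: "?Dv \<le> ?E * ?Pv" "?Pv \<le> ?E * ?Dv" using Suc.IH[OF _ v_sub z] Suc.prems(1) by auto
  have x: "x (Suc n) \<in> {0..1}" using fixed_point[OF i] by simp
  have "\<bar>deriv01 (word_map \<phi> u) (x (Suc n))\<bar> = ?Pu"
    using deriv01_power_at_fixed_point(2)[OF i, of k] by (simp add: u power_abs)
  \<comment> \<open>A trivial rearrangement (\<open>refl\<close>) still allows the base point to
    move, here from \<open>y\<close> to the fixed point.\<close>
  then have uu: "?Du \<le> C * ?Pu" "?Pu \<le> C * ?Du"
    using deriv01_rearrange[OF refl u_sub Suc.prems(3) x]
      deriv01_rearrange[OF refl u_sub x Suc.prems(3)] by auto
  have C0: "0 \<le> C" using C_ge_1 by simp
  have "?Dw \<le> C * (?Dv * ?Du)"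
    using deriv01_rearrange[OF ms w_sub Suc.prems(3,3)] Dvu by simp
  also have "\<dots> \<le> C * ((?E * ?Pv) * (C * ?Pu))"
    using v uu C0 by (intro mult_left_mono mult_mono) auto
  finally have 1: "?Dw \<le> C ^ (2 * Suc n) * (?Pv * ?Pu)" by (simp add: mult_ac)
  have "?Pv * ?Pu \<le> (?E * ?Dv) * (C * ?Du)"
    using v uu C0 by (intro mult_mono) auto
  also have "\<dots> = ?E * C * (?Dv * ?Du)" by (simp add: mult_ac)
  also have "\<dots> \<le> ?E * C * (C * ?Dw)"
    using deriv01_rearrange[OF ms[symmetric] vu_sub Suc.prems(3,3)] Dvu C0
    by (intro mult_left_mono) auto
  finally have 2: "?Pv * ?Pu \<le> C ^ (2 * Suc n) * ?Dw" by (simp add: mult_ac)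
  show ?case using 1 2 Pw by simp
qed

lemma multiplier_nonzero: "i \<in> {1..m} \<Longrightarrow> multiplier i \<noteq> 0"
  using deriv_nonzero fixed_point by blast

text \<open>By the mean value theorem an increment of the composed map is \<open>y - z\<close> times
  a derivative, and that derivative is comparable with the product of the multipliers.\<close>

lemma word_map_comparable:
  assumes w: "set w \<subseteq> {1..m}" and ab: "{a..b} \<subseteq> {0..1}"
  shows "comparable_increments (C ^ (2 * m)) (scaled_dist \<phi> multiplier w) (\<lambda>x. x) a b"
proof -
  let ?P = "\<bar>prod_list (map multiplier w)\<bar>" and ?E = "C ^ (2 * m)"
  have P0: "0 < ?P" using w multiplier_nonzero by (auto simp: prod_list_zero_iff)
  have "y - z \<le> ?E * scaled_dist \<phi> multiplier w z y \<and>
      scaled_dist \<phi> multiplier w z y \<le> ?E * (y - z)"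
    if zy: "a \<le> z" "z \<le> y" "y \<le> b" for z y
  proof (cases "z = y")
    case True
    then show ?thesis by (simp add: scaled_dist_def)
  next
    case False
    then have "z < y" using zy by simp
    have in01: "t \<in> {0..1}" if "z \<le> t" "t \<le> y" for t using that zy ab by auto
    have der: "(word_map \<phi> w has_real_derivative deriv01 (word_map \<phi> w) t) (at t within {0..1})"
      if "z \<le> t" "t \<le> y" for t using word_map_derivative[OF w in01[OF that]] .
    have "continuous_on {0..1} (word_map \<phi> w)"
      using word_map_derivative[OF w] by (rule DERIV_continuous_on)
    then have cont: "continuous_on {z..y} (word_map \<phi> w)"
      by (rule continuous_on_subset) (use in01 in auto)
    \<comment> \<open>At interior points the derivative within \<open>[0,1]\<close> is the two-sided
      one that the mean value theorem requires.\<close>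
    have "(word_map \<phi> w has_real_derivative deriv01 (word_map \<phi> w) t) (at t)"
      if "z < t" "t < y" for t
    proof -
      have "0 < t" "t < 1" using that in01[of z] in01[of y] zy by auto
      then have "at t within {0..1} = at t" by (intro at_within_Icc_at)
      then show ?thesis using der[of t] that by simp
    qed
    then obtain t where t: "z < t" "t < y"
      "word_map \<phi> w y - word_map \<phi> w z = (y - z) * deriv01 (word_map \<phi> w) t"
      using MVT[OF \<open>z < y\<close> cont] by (metis DERIV_unique real_differentiable_def)
    let ?D = "\<bar>deriv01 (word_map \<phi> w) t\<bar>"
    have D: "?D \<le> ?E * ?P" "?P \<le> ?E * ?D"
      using deriv01_comparable_multipliers[OF le_refl w in01[of t]] t by auto
    have s: "scaled_dist \<phi> multiplier w z y = (y - z) * ?D / ?P"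
      using t zy by (simp add: scaled_dist_def abs_minus_commute abs_mult)
    have "(y - z) * ?P \<le> (y - z) * (?E * ?D)" "(y - z) * ?D \<le> (y - z) * (?E * ?P)"
      using D zy by (auto intro: mult_left_mono)
    then show ?thesis unfolding s using P0 by (simp add: pos_le_divide_eq pos_divide_le_eq mult_ac)
  qed
  then show ?thesis by (simp add: comparable_increments_def)
qed

end

section \<open>Uniqueness of the generated measure\<close>

text \<open>One step of self-similarity shrinks the required neighbourhood by the contraction ratio \<open>r\<close>;
  at radius \<open>1\<close> there is nothing to prove, since the unit interval has diameter \<open>1\<close>.\<close>

lemma emeasure_le_of_neighbourhood:
  assumes \<mu>: "generated_measure m f \<rho> \<mu>" and \<nu>: "generated_measure m f \<rho> \<nu>"
    and cont: "\<And>i. i \<in> {1..m} \<Longrightarrow> continuous_on {0..1} (f i)"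
    and into: "\<And>i y. \<lbrakk>i \<in> {1..m}; y \<in> {0..1}\<rbrakk> \<Longrightarrow> f i y \<in> {0..1}"
    and contr: "\<And>i y z. \<lbrakk>i \<in> {1..m}; y \<in> {0..1}; z \<in> {0..1}\<rbrakk> \<Longrightarrow> \<bar>f i y - f i z\<bar> \<le> r * \<bar>y - z\<bar>"
    and r: "0 \<le> r"
    and EF: "E \<in> sets \<mu>" "F \<in> sets \<mu>"
    and nbh: "\<And>e y. \<lbrakk>e \<in> E; y \<in> {0..1}; \<bar>y - e\<bar> \<le> r ^ n\<rbrakk> \<Longrightarrow> y \<in> F"
  shows "emeasure \<mu> E \<le> emeasure \<nu> F"
  using EF nbh
proof (induction n arbitrary: E F)
  case 0
  have s: "sets \<mu> = sets (restrict_space borel {0..1})" "sets \<nu> = sets \<mu>" "space \<mu> = {0..1}"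
    and t: "emeasure \<mu> {0..1} = 1" "emeasure \<nu> {0..1} = 1"
    using \<mu> \<nu> by (simp_all add: generated_measure_def)
  have E01: "E \<subseteq> {0..1}" "F \<subseteq> {0..1}" using 0(1,2) sets.sets_into_space s(3) by blast+
  show ?case
  proof (cases "E = {}")
    case False
    then obtain e where e: "e \<in> E" by auto
    have "{0..1} \<subseteq> F"
    proof
      fix y :: real assume "y \<in> {0..1}"
      moreover have "e \<in> {0..1}" using e E01 by auto
      ultimately show "y \<in> F" using 0(3)[OF e, of y] by (simp add: abs_le_iff)
    qed
    then have "F = {0..1}" using E01 by auto
    moreover have "emeasure \<mu> E \<le> emeasure \<mu> {0..1}"
      using E01 sets.top[of \<mu>] s(3) by (intro emeasure_mono) auto
    ultimately show ?thesis using t by simp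
  qed simp
next
  case (Suc n)
  have s: "sets \<mu> = sets (restrict_space borel {0..1})" "sets \<nu> = sets \<mu>" "space \<mu> = {0..1}"
    using \<mu> \<nu> by (simp_all add: generated_measure_def)
  have meas: "f i -` X \<inter> {0..1} \<in> sets \<mu>" if "i \<in> {1..m}" "X \<in> sets \<mu>" for i X
  proof -
    have "f i \<in> measurable \<mu> \<mu>"
      using borel_measurable_continuous_on_restrict[OF cont[OF that(1)]] into[OF that(1)]
      by (subst measurable_cong_sets[OF s(1,1)], intro measurable_restrict_space2)
        (auto simp: space_restrict_space)
    then show ?thesis using measurable_sets that(2) s(3) by metis
  qed
  have "emeasure \<mu> (f i -` E \<inter> {0..1}) \<le> emeasure \<nu> (f i -` F \<inter> {0..1})" if i: "i \<in> {1..m}" for i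
  proof (rule Suc.IH)
    fix e y assume e: "e \<in> f i -` E \<inter> {0..1}" and y: "y \<in> {0..1}" "\<bar>y - e\<bar> \<le> r ^ n"
    have "\<bar>f i y - f i e\<bar> \<le> r * \<bar>y - e\<bar>" using contr[OF i] e y by auto
    also have "\<dots> \<le> r * r ^ n" using y r by (intro mult_left_mono)
    finally show "y \<in> f i -` F \<inter> {0..1}"
      using Suc.prems(3)[of "f i e" "f i y"] e y into[OF i] by simp
  qed (use meas[OF i] Suc.prems in auto)
  then have "(\<Sum>i=1..m. ennreal (\<rho> i) * emeasure \<mu> (f i -` E \<inter> {0..1}))
      \<le> (\<Sum>i=1..m. ennreal (\<rho> i) * emeasure \<nu> (f i -` F \<inter> {0..1}))"
    by (intro sum_mono mult_left_mono) auto
  then show ?case using \<mu> \<nu> Suc.prems(1,2) s(2) by (simp add: generated_measure_def)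
qed

text \<open>Enlarging a half-line by \<open>r ^ n\<close> captures its neighbourhood of that radius,
  so the preceding estimate applies. The enlargements decrease to the half-line, and continuity from
  above of the finite measure \<open>\<nu>\<close> gives the limit.\<close>

lemma emeasure_atMost_le:
  assumes \<mu>: "generated_measure m f \<rho> \<mu>" and \<nu>: "generated_measure m f \<rho> \<nu>"
    and cont: "\<And>i. i \<in> {1..m} \<Longrightarrow> continuous_on {0..1} (f i)"
    and into: "\<And>i y. \<lbrakk>i \<in> {1..m}; y \<in> {0..1}\<rbrakk> \<Longrightarrow> f i y \<in> {0..1}"
    and contr: "\<And>i y z. \<lbrakk>i \<in> {1..m}; y \<in> {0..1}; z \<in> {0..1}\<rbrakk> \<Longrightarrow> \<bar>f i y - f i z\<bar> \<le> r * \<bar>y - z\<bar>"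
    and r: "0 \<le> r" "r < 1"
  shows "emeasure \<mu> ({..t} \<inter> {0..1}) \<le> emeasure \<nu> ({..t} \<inter> {0..1})"
proof -
  have s: "sets \<mu> = sets (restrict_space borel {0..1})" "sets \<nu> = sets \<mu>"
      "emeasure \<nu> {0..1} = 1" "space \<nu> = {0..1}"
    using \<mu> \<nu> by (simp_all add: generated_measure_def)
  define A where "A n = {..t + r ^ n} \<inter> {0..1}" for n
  have ms: "{..t} \<inter> {0..1} \<in> sets \<mu>" for t :: real
    unfolding s by (auto simp: sets_restrict_space_iff)
  have "emeasure \<mu> ({..t} \<inter> {0..1}) \<le> emeasure \<nu> (A n)" for n
    unfolding A_def
    by (rule emeasure_le_of_neighbourhood[OF \<mu> \<nu> cont into contr r(1) ms ms, where n = n]) auto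
  moreover have "(\<lambda>n. emeasure \<nu> (A n)) \<longlonglongrightarrow> emeasure \<nu> (\<Inter>n. A n)"
  proof (rule Lim_emeasure_decseq)
    show "range A \<subseteq> sets \<nu>" using ms s(2) by (auto simp: A_def)
    show "decseq A" 
    proof (rule decseq_SucI)
      fix n
      have "r ^ Suc n \<le> r ^ n" using r by (simp add: mult_left_le_one_le)
      then show "A (Suc n) \<subseteq> A n" by (auto simp: A_def)
    qed
    fix n
    have "emeasure \<nu> (A n) \<le> emeasure \<nu> (space \<nu>)" by (rule emeasure_space)
    then have "emeasure \<nu> (A n) \<le> 1" using s by simp
    then show "emeasure \<nu> (A n) \<noteq> \<infinity>" by (auto simp: top_unique)
  qed
  moreover have "(\<Inter>n. A n) = {..t} \<inter> {0..1}"
  proof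
    have "y \<le> t + r ^ n" if "y \<le> t" for y n
      using that zero_le_power[OF r(1), of n] by linarith
    then show "{..t} \<inter> {0..1} \<subseteq> (\<Inter>n. A n)" by (auto simp: A_def)
    show "(\<Inter>n. A n) \<subseteq> {..t} \<inter> {0..1}"
    proof
      fix y assume y: "y \<in> (\<Inter>n. A n)"
      have "(\<lambda>n. t + r ^ n) \<longlonglongrightarrow> t + 0"
        using r by (intro tendsto_intros LIMSEQ_realpow_zero) auto
      then have "y \<le> t + 0" using y by (intro LIMSEQ_le_const) (auto simp: A_def)
      then show "y \<in> {..t} \<inter> {0..1}" using y by (auto simp: A_def)
    qed
  qed
  ultimately show ?thesis by (intro LIMSEQ_le_const[of "\<lambda>n. emeasure \<nu> (A n)"]) auto
qed

text \<open>Exchanging the two measures turns the one-sided bound into equality on traces of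
  half-lines, an intersection-stable generator of the Borel sets of \<open>[0,1]\<close>.\<close>

lemma generated_measure_unique:
  assumes \<mu>: "generated_measure m f \<rho> \<mu>" and \<nu>: "generated_measure m f \<rho> \<nu>"
    and cont: "\<And>i. i \<in> {1..m} \<Longrightarrow> continuous_on {0..1} (f i)"
    and into: "\<And>i y. \<lbrakk>i \<in> {1..m}; y \<in> {0..1}\<rbrakk> \<Longrightarrow> f i y \<in> {0..1}"
    and contr: "\<And>i y z. \<lbrakk>i \<in> {1..m}; y \<in> {0..1}; z \<in> {0..1}\<rbrakk> \<Longrightarrow> \<bar>f i y - f i z\<bar> \<le> r * \<bar>y - z\<bar>"
    and r: "0 \<le> r" "r < 1"
  shows "\<mu> = \<nu>"
proof -
  have s: "sets \<mu> = sets (restrict_space borel {0..1})" "sets \<nu> = sets (restrict_space borel {0..1})"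
      "emeasure \<mu> {0..1} = 1" "emeasure \<nu> {0..1} = 1" "space \<mu> = {0..1}" "space \<nu> = {0..1}"
    using \<mu> \<nu> by (simp_all add: generated_measure_def)
  let ?E = "range (\<lambda>t::real. {..t} \<inter> {0..1})"
  have sig: "sets (restrict_space borel {0..1::real}) = sigma_sets {0..1} ?E"
  proof -
    have borel: "sets (borel :: real measure) = sigma_sets UNIV (range (\<lambda>t. {..t}))"
      by (subst borel_eq_atMost) (rule sets_measure_of, simp)
    then have "{0..1} \<in> sigma_sets UNIV (range (\<lambda>t::real. {..t}))"
      using borel_closed[of "{0..1::real}"] by simp
    then have "sets (restrict_space borel {0..1::real}) =
        sigma_sets {0..1} ((\<inter>) {0..1} ` range (\<lambda>t::real. {..t}))"
      using sigma_sets_Int[of "{0..1}" UNIV "range (\<lambda>t::real. {..t})"]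
      by (simp only: sets_restrict_space borel subset_UNIV)
    then show ?thesis by (simp add: image_image Int_commute)
  qed
  have Int: "Int_stable ?E"
  proof (rule Int_stableI)
    fix a b assume "a \<in> ?E" "b \<in> ?E"
    then obtain s t :: real where "a = {..s} \<inter> {0..1}" "b = {..t} \<inter> {0..1}" by auto
    then have "a \<inter> b = {..min s t} \<inter> {0..1}" by auto
    then show "a \<inter> b \<in> ?E" by blast
  qed
  show ?thesis
  proof (rule measure_eqI_generator_eq[OF Int, where \<Omega> = "{0..1}" and A = "\<lambda>_. {0..1}"])
    show "emeasure \<mu> X = emeasure \<nu> X" if "X \<in> ?E" for X
      using that emeasure_atMost_le[OF \<mu> \<nu> cont into contr r]
        emeasure_atMost_le[OF \<nu> \<mu> cont into contr r] by (auto intro: antisym)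
    show "sets \<mu> = sigma_sets {0..1} ?E" "sets \<nu> = sigma_sets {0..1} ?E" using s sig by auto
    \<comment> \<open>The half-line ending at 1 has the whole interval as its trace.\<close>
    show "range (\<lambda>_. {0..1}) \<subseteq> ?E" by (auto intro!: image_eqI[of _ _ 1])
  qed (use s in auto)
qed

section \<open>Extension to the unit interval\<close>

lemma comparable_increments_weaken:
  assumes "comparable_increments L (\<lambda>x y. y - x) h u v" "0 < L" "L \<le> L'"
  shows "comparable_increments L' (\<lambda>x y. y - x) h u v"
proof (rule comparable_incrementsI)
  fix x y assume xy: "u \<le> x" "x \<le> y" "y \<le> v"
  note * = comparable_incrementsD[OF assms(1) xy]
  show "h y - h x \<le> L' * (y - x)"
    using *(1) mult_right_mono[OF assms(3), of "y - x"] xy by simp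
  \<comment> \<open>The increment of \<open>h\<close> must be known to be nonnegative before its
    factor may be enlarged.\<close>
  have "0 \<le> L * (h y - h x)" using *(2) xy by simp
  then have "0 \<le> h y - h x" using assms(2) by (simp add: zero_le_mult_iff)
  then show "y - x \<le> L' * (h y - h x)"
    using *(2) mult_right_mono[OF assms(3), of "h y - h x"] by simp
qed

text \<open>Degenerate segments are allowed because a hull may reach 0 or 1; the equivalence rules
  out collapsing only one of the two.\<close>

lemma affine_segment:
  assumes "u \<le> v" "U \<le> V" "u = v \<longleftrightarrow> U = V"
  obtains h L where "0 < L" "comparable_increments L (\<lambda>x y. y - x) h u v" "h u = U" "h v = V"
proof (cases "u = v")
  case True
  then show ?thesis using that[of 1 "\<lambda>_. U"] assms(3) by (simp add: comparable_increments_def)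
next
  case False
  define k where "k = (V - U) / (v - u)"
  have k: "0 < k" using False assms by (simp add: k_def less_le)
  have "comparable_increments 1 (\<lambda>x y. y - x) (\<lambda>x. x) u v" by (simp add: comparable_increments_def)
  then have "comparable_increments (k + 1 / k) (\<lambda>x y. y - x) (\<lambda>x. U + k * (x - u)) u v"
    using k by (intro comparable_increments_affine) auto
  moreover have "U + k * (v - u) = V" using False by (simp add: k_def)
  moreover have "0 < k + 1 / k" using k by (simp add: add_pos_pos)
  ultimately show ?thesis using that[of "k + 1 / k" "\<lambda>x. U + k * (x - u)"] by simp
qed

lemma join_increments:
  assumes "comparable_increments L (\<lambda>x y. y - x) g u v" "0 < L"
    and "comparable_increments M (\<lambda>x y. y - x) h v z" "0 < M" "g v = h v"
  obtains k N where "0 < N" "comparable_increments N (\<lambda>x y. y - x) k u z"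
    "\<And>x. x \<le> v \<Longrightarrow> k x = g x" "\<And>x. v \<le> x \<Longrightarrow> k x = h x"
proof -
  obtain k where k: "\<And>x. x \<le> v \<Longrightarrow> k x = g x" "\<And>x. v \<le> x \<Longrightarrow> k x = h x"
    using glue_at[of g v h] assms(5) by metis
  have "comparable_increments (max L M) (\<lambda>x y. y - x) k u v"
    by (rule comparable_increments_cong[OF comparable_increments_weaken[OF assms(1,2)]]) (auto simp: k)
  moreover have "comparable_increments (max L M) (\<lambda>x y. y - x) k v z"
    by (rule comparable_increments_cong[OF comparable_increments_weaken[OF assms(3,4)]]) (auto simp: k)
  ultimately have "comparable_increments (max L M) (\<lambda>x y. y - x) k u z"
    by (rule comparable_increments_join) simp
  then show ?thesis using that[of "max L M" k] k assms(2) by simp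
qed

text \<open>Affine pieces on \<open>[0,a]\<close> and \<open>[b,1]\<close> are glued to
  \<open>g\<close>. The two equivalences ensure that each outer piece is degenerate on both sides or
  on neither.\<close>

lemma extend_to_unit_interval:
  assumes g: "0 < L" "comparable_increments L (\<lambda>x y. y - x) g a b" "g a = A" "g b = B"
    and "0 \<le> a" "a \<le> b" "b \<le> 1" "0 \<le> A" "A \<le> B" "B \<le> 1" "a = 0 \<longleftrightarrow> A = 0" "b = 1 \<longleftrightarrow> B = 1"
  obtains G N where "0 < N" "comparable_increments N (\<lambda>x y. y - x) G 0 1" "G 0 = 0" "G 1 = 1"
    "\<And>x. x \<in> {a..b} \<Longrightarrow> G x = g x"
proof -
  obtain h1 L1 where h1: "0 < L1" "comparable_increments L1 (\<lambda>x y. y - x) h1 0 a" "h1 0 = 0" "h1 a = A"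
    using affine_segment[of 0 a 0 A] assms by metis
  obtain h2 L2 where h2: "0 < L2" "comparable_increments L2 (\<lambda>x y. y - x) h2 b 1" "h2 b = B" "h2 1 = 1"
    using affine_segment[of b 1 B 1] assms by metis
  obtain k1 N1 where k1: "0 < N1" "comparable_increments N1 (\<lambda>x y. y - x) k1 0 b"
    "\<And>x. x \<le> a \<Longrightarrow> k1 x = h1 x" "\<And>x. a \<le> x \<Longrightarrow> k1 x = g x"
    using join_increments[OF h1(2,1) g(2,1)] h1(4) g(3) by metis
  have "k1 b = h2 b" using k1(4)[OF \<open>a \<le> b\<close>] g(4) h2(3) by simp
  then obtain k2 N2 where k2: "0 < N2" "comparable_increments N2 (\<lambda>x y. y - x) k2 0 1"
    "\<And>x. x \<le> b \<Longrightarrow> k2 x = k1 x" "\<And>x. b \<le> x \<Longrightarrow> k2 x = h2 x"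
    using join_increments[OF k1(2,1) h2(2,1)] by metis
  show ?thesis
    by (rule that[OF k2(1,2)]) (use k1 k2 h1 h2 assms in auto)
qed

text \<open>The two inequalities are Lipschitz bounds for \<open>g\<close> and for its inverse with
  the same constant; surjectivity follows from the values at 0 and 1 by connectedness.\<close>

lemma W1inf_diffeo01_increasing:
  assumes "0 < L" "comparable_increments L (\<lambda>x y. y - x) g 0 1" "g 0 = 0" "g 1 = 1"
  shows "W1inf_diffeo01 g"
proof -
  have bnd: "\<bar>g y - g x\<bar> \<le> L * \<bar>y - x\<bar> \<and> \<bar>y - x\<bar> \<le> L * \<bar>g y - g x\<bar>"
    and mono: "x \<le> y \<Longrightarrow> g x \<le> g y" if "x \<in> {0..1}" "y \<in> {0..1}" for x y
  proof -
    have *: "g x \<le> g y \<and> \<bar>g y - g x\<bar> \<le> L * \<bar>y - x\<bar> \<and> \<bar>y - x\<bar> \<le> L * \<bar>g y - g x\<bar>"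
      if "0 \<le> x" "x \<le> y" "y \<le> 1" for x y
    proof -
      note * = comparable_incrementsD[OF assms(2) that]
      then have "0 \<le> L * (g y - g x)" using that by simp
      then have "0 \<le> g y - g x" using assms(1) by (simp add: zero_le_mult_iff)
      then show ?thesis using * that by simp
    qed
    show "\<bar>g y - g x\<bar> \<le> L * \<bar>y - x\<bar> \<and> \<bar>y - x\<bar> \<le> L * \<bar>g y - g x\<bar>"
      using *[of x y] *[of y x] that by (cases "x \<le> y") (auto simp: abs_minus_commute)
    show "x \<le> y \<Longrightarrow> g x \<le> g y" using * that by auto
  qed
  have lip: "L-lipschitz_on {0..1} g"
    using bnd assms(1) by (intro lipschitz_onI) (auto simp: dist_real_def)
  have inj: "inj_on g {0..1}"
    using bnd by (fastforce intro!: inj_onI)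
  have "g ` {0..1} = {0..1}"
  proof
    show "g ` {0..1} \<subseteq> {0..1}" using mono[of 0] mono[of _ 1] assms(3,4) by auto
    have "connected (g ` {0..1})"
      using lipschitz_on_continuous_on[OF lip] by (intro connected_continuous_image) auto
    moreover have "0 \<in> g ` {0..1}" "1 \<in> g ` {0..1}" using assms(3,4) by (auto intro: rev_image_eqI)
    ultimately show "{0..1} \<subseteq> g ` {0..1}" using connected_contains_Icc by blast
  qed
  then have bij: "bij_betw g {0..1} {0..1}" using inj by (simp add: bij_betw_def)
  have "L-lipschitz_on {0..1} (the_inv_into {0..1} g)"
  proof (rule lipschitz_onI)
    fix u v :: real assume "u \<in> {0..1}" "v \<in> {0..1}"
    then have "the_inv_into {0..1} g w \<in> {0..1} \<and> g (the_inv_into {0..1} g w) = w" if "w \<in> {u, v}" for w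
      using that bij f_the_inv_into_f_bij_betw[OF bij] bij_betwE[OF bij_betw_the_inv_into[OF bij]] by auto
    then show "dist (the_inv_into {0..1} g u) (the_inv_into {0..1} g v) \<le> L * dist u v"
      using bnd[of "the_inv_into {0..1} g v" "the_inv_into {0..1} g u"] by (simp add: dist_real_def)
  qed (use assms in simp)
  then show ?thesis using bij lip by (auto simp: W1inf_diffeo01_def)
qed

section \<open>Pairing the two systems and transporting the measure\<close>

theorem lemma7:
  fixes m :: nat
    and \<phi> S :: "nat \<Rightarrow> real \<Rightarrow> real"
    and \<rho> c x :: "nat \<Rightarrow> real"
    and \<mu> \<mu>\<^sub>0 :: "real measure"
  assumes "2 \<le> m"
    and "conformal_ifs m \<phi> \<rho>"
    and "generated_measure m \<phi> \<rho> \<mu>"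
    and "(\<Sum>i=1..m. sup_norm01 (deriv01 (\<phi> i))) < 1"
    and "strong_bounded_distortion m \<phi>"
    and "\<And>i. i \<in> {1..m} \<Longrightarrow> x i \<in> {0..1} \<and> \<phi> i (x i) = x i"
    and "S = (\<lambda>i y. c i + deriv01 (\<phi> i) (x i) * y)"
    and "same_structure m S \<phi>"
    and "generated_measure m S \<rho> \<mu>\<^sub>0"
    \<comment> \<open>Necessary for an increasing \<open>g\<close>: it maps the support of \<open>\<mu>\<close> onto that of \<open>\<mu>\<^sub>0\<close> and fixes
        \<open>0\<close> and \<open>1\<close>. It does not follow from the other assumptions: take
        \<open>\<phi>\<^sub>1(y) = y/3\<close>, \<open>\<phi>\<^sub>2(y) = y/3 + 2/3\<close> and \<open>c\<^sub>1 = 1/10\<close>, \<open>c\<^sub>2 = 1/2\<close>.\<close>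
    and "measure_support \<mu> \<inter> {0, 1} = measure_support \<mu>\<^sub>0 \<inter> {0, 1}"
  shows "\<exists>g. W1inf_diffeo01 g \<and> (\<forall>E\<in>sets \<mu>. emeasure \<mu> E = emeasure \<mu>\<^sub>0 (g ` E))"
proof -
  have diffeo\<phi>: "\<exists>\<gamma>>0. \<forall>i\<in>{1..m}. C1_holder_diffeo_on \<gamma> {0..1} (\<phi> i)"
    and open_into: "\<forall>i\<in>{1..m}. \<phi> i ` {0<..<1} \<subseteq> {0<..<1}"
    and deriv\<phi>: "\<forall>i\<in>{1..m}. \<forall>y\<in>{0..1}. 0 < \<bar>deriv01 (\<phi> i) y\<bar> \<and> \<bar>deriv01 (\<phi> i) y\<bar> < 1"
    and weights: "\<forall>i\<in>{1..m}. 0 < \<rho> i"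
    and asc: "ascending m \<phi>"
    using assms(2) unfolding conformal_ifs_def by - (elim conjE; assumption)+
  have intervalsS: "\<forall>i\<in>{1..m}. affine_contraction01 (S i) \<and> S i ` {0..1} \<subseteq> {0..1}"
    and ascS: "ascending m S"
    and orientS: "\<forall>i\<in>{1..m}. changes_orientation (S i) \<longleftrightarrow> changes_orientation (\<phi> i)"
    and touchS: "\<forall>i\<in>{1..<m}. S i ` {0..1} \<inter> S (Suc i) ` {0..1} \<noteq> {} \<longleftrightarrow>
        \<phi> i ` {0..1} \<inter> \<phi> (Suc i) ` {0..1} \<noteq> {}"
    using assms(8) unfolding same_structure_def by - (elim conjE; assumption)+
  define d where "d i = deriv01 (\<phi> i) (x i)" for i
  have S: "S i y = c i + d i * y" for i y by (simp add: assms(7) d_def)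
  have dif: "\<phi> i differentiable (at y within {0..1})" if "i \<in> {1..m}" "y \<in> {0..1}" for i y
    using diffeo\<phi> that by (auto simp: C1_holder_diffeo_on_def C1_holder_on_def)
  have inj\<phi>: "inj_on (\<phi> i) {0..1}" if "i \<in> {1..m}" for i
    using diffeo\<phi> that by (auto simp: C1_holder_diffeo_on_def)
  have cont\<phi>: "continuous_on {0..1} (\<phi> i)" if "i \<in> {1..m}" for i
    using dif[OF that] by (intro differentiable_imp_continuous_on) (simp add: differentiable_on_def)
  \<comment> \<open>The inclusion is given on the open interval and passes to its closure by
    continuity.\<close>
  have into\<phi>: "\<phi> i y \<in> {0..1}" if "i \<in> {1..m}" "y \<in> {0..1}" for i y
  proof -
    have cl: "closure {0<..<1::real} = {0..1}" by (simp add: closure_greaterThanLessThan)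
    have "\<phi> i ` {0<..<1} \<subseteq> {0<..<1}" using open_into that(1) by (rule bspec)
    also have "\<dots> \<subseteq> {0..1}" by auto
    finally have "\<phi> i ` closure {0<..<1} \<subseteq> {0..1}"
      using cont\<phi>[OF that(1)] unfolding cl[symmetric] by (rule image_closure_subset[rotated 2]) simp
    then show ?thesis using that(2) unfolding cl by blast
  qed
  have deriv: "0 < \<bar>deriv01 (\<phi> i) y\<bar>" "\<bar>deriv01 (\<phi> i) y\<bar> < 1" if "i \<in> {1..m}" "y \<in> {0..1}" for i y
    using deriv\<phi> that by auto
  have d: "d i \<noteq> 0" "\<bar>d i\<bar> < 1" if "i \<in> {1..m}" for i
    using deriv[OF that] assms(6)[OF that] by (auto simp: d_def)
  have \<rho>: "0 < \<rho> i" if "i \<in> {1..m}" for i using weights that by simp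
  have contS: "continuous_on {0..1} (S i)" for i
    by (simp add: S[abs_def] continuous_intros)
  have intoS: "S i y \<in> {0..1}" if "i \<in> {1..m}" "y \<in> {0..1}" for i y
  proof -
    have "S i ` {0..1} \<subseteq> {0..1}" using intervalsS that(1) by blast
    then show ?thesis using that(2) by blast
  qed

  interpret P: interval_ifs m \<phi> \<rho> \<mu>
    proof
    show "ascending m \<phi>" by (rule asc)
  qed (use assms(1,3) cont\<phi> inj\<phi> into\<phi> \<rho> in auto)
  interpret Q: interval_ifs m S \<rho> \<mu>\<^sub>0
  proof
    show "inj_on (S i) {0..1}" if "i \<in> {1..m}" for i
      using d(1)[OF that] by (intro inj_onI) (simp add: S)
  qed (use assms(1,9) ascS contS intoS \<rho> in auto)

  have up: "Q.up = P.up"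
    using orientS by (auto simp: fun_eq_iff P.up_def Q.up_def)
  have K01: "0 \<in> P.K \<longleftrightarrow> 0 \<in> Q.K" "1 \<in> P.K \<longleftrightarrow> 1 \<in> Q.K" using assms(10) by auto
  have ends: "P.a = 0 \<longleftrightarrow> Q.a = 0" "P.b = 1 \<longleftrightarrow> Q.b = 1"
    using K01 P.a_eq_0_iff P.b_eq_1_iff Q.a_eq_0_iff Q.b_eq_1_iff by auto

  obtain C where C: "1 \<le> C"
    "\<And>w \<sigma> y z. \<lbrakk>set w \<subseteq> {1..m}; \<sigma> permutes {..<length w}; y \<in> {0..1}; z \<in> {0..1}\<rbrakk> \<Longrightarrow>
      \<bar>deriv01 (word_map \<phi> w) y / deriv01 (word_map \<phi> (permute_list \<sigma> w)) z\<bar> \<le> C"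
    using assms(5) unfolding strong_bounded_distortion_def by blast
  interpret D: distorted_ifs m \<phi> x C
    proof
    show "deriv01 (\<phi> i) y \<noteq> 0" if "i \<in> {1..m}" "y \<in> {0..1}" for i y using deriv(1)[OF that] by simp
  qed (rule dif into\<phi> assms(6) C; assumption)+

  interpret R: paired_hull_systems m \<phi> S P.up P.a P.b Q.a Q.b c d "C ^ (2 * m)"
  proof -
    interpret Q': tight_hull_system m S P.up Q.a Q.b
      using Q.tight_hull_system_axioms unfolding up .
    show "paired_hull_systems m \<phi> S P.up P.a P.b Q.a Q.b c d (C ^ (2 * m))"
    proof
      \<comment> \<open>By \<open>hulls_touch_iff\<close>, whether hulls touch is decided by whether
        the full images touch, by the orientations, and by whether the hulls reach 0 or 1. All of
        these agree for the two systems.\<close>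
      fix i assume i: "i \<in> {1..<m}"
      have "\<phi> i ` {0..1} \<inter> \<phi> (Suc i) ` {0..1} \<noteq> {} \<longleftrightarrow> S i ` {0..1} \<inter> S (Suc i) ` {0..1} \<noteq> {}"
        using touchS i by blast
      then show "P.hi i = P.lo (Suc i) \<longleftrightarrow> Q'.hi i = Q'.lo (Suc i)"
        using P.hulls_touch_iff[OF i] Q.hulls_touch_iff[OF i] ends unfolding up by simp
    next
      show "comparable_increments (C ^ (2 * m)) (scaled_dist \<phi> d w) (\<lambda>x. x) P.a P.b"
        if "set w \<subseteq> {1..m}" for w
        using D.word_map_comparable[OF that P.hull_subset] unfolding d_def[abs_def] .
    qed (use S d in auto)
  qed

  have ab: "0 \<le> P.a" "P.a < P.b" "P.b \<le> 1" "0 \<le> Q.a" "Q.a < Q.b" "Q.b \<le> 1"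
    using P.hull_subset P.a_less_b Q.hull_subset Q.a_less_b by auto
  obtain g0 L0 where g0: "0 < L0" "comparable_increments L0 (\<lambda>x y. y - x) g0 P.a P.b"
    "g0 P.a = Q.a" "g0 P.b = Q.b"
    "\<And>i y. \<lbrakk>i \<in> {1..m}; y \<in> {P.a..P.b}\<rbrakk> \<Longrightarrow> g0 (\<phi> i y) = S i (g0 y)"
    by (rule R.conjugacy_exists) (rule that)
  obtain g L where g: "0 < L" "comparable_increments L (\<lambda>x y. y - x) g 0 1" "g 0 = 0" "g 1 = 1"
    "\<And>y. y \<in> {P.a..P.b} \<Longrightarrow> g y = g0 y"
    by (rule extend_to_unit_interval[OF g0(1-4) ab(1) less_imp_le[OF ab(2)] ab(3,4)
          less_imp_le[OF ab(5)] ab(6) ends]) (rule that)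
  \<comment> \<open>The hull is invariant, so \<open>g\<close> coincides with \<open>g0\<close> at
    both \<open>y\<close> and \<open>\<phi> i y\<close>.\<close>
  have conj: "g (\<phi> i y) = S i (g y)" if "i \<in> {1..m}" "y \<in> {P.a..P.b}" for i y
    using g0(5)[OF that] g(5) that P.maps_hull[OF that] by simp
  have diffeo: "W1inf_diffeo01 g" using W1inf_diffeo01_increasing[OF g(1-4)] .
  then have bij: "bij_betw g {0..1} {0..1}" by (simp add: W1inf_diffeo01_def)
  let ?B = "restrict_space borel {0..1::real}"
  have lip_meas: "h \<in> measurable ?B ?B" if "L-lipschitz_on {0..1} h" "bij_betw h {0..1} {0..1}"
    for h :: "real \<Rightarrow> real" and L
    using borel_measurable_continuous_on_restrict[OF lipschitz_on_continuous_on[OF that(1)]]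
      bij_betwE[OF that(2)]
    by (intro measurable_restrict_space2) (auto simp: space_restrict_space)
  have g_meas: "g \<in> measurable ?B ?B"
    using diffeo bij lip_meas by (auto simp: W1inf_diffeo01_def)
  then have g_meas\<mu>: "g \<in> measurable \<mu> ?B"
    by (subst measurable_cong_sets[OF P.sets_\<mu> refl])
  have inv_meas: "the_inv_into {0..1} g \<in> measurable ?B ?B"
    using diffeo bij_betw_the_inv_into[OF bij] lip_meas by (auto simp: W1inf_diffeo01_def)

  \<comment> \<open>The push-forward of \<open>\<mu>\<close> under \<open>g\<close> will be shown to
    be generated by \<open>S\<close>.\<close>
  define \<nu> where "\<nu> = distr \<mu> ?B g"
  have \<nu>: "emeasure \<nu> E = emeasure \<mu> (g -` E \<inter> {0..1})" if "E \<in> sets ?B" for E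
    using emeasure_distr[OF g_meas\<mu> that] by (simp add: \<nu>_def P.space_\<mu>)
  have g_vimage: "g -` E \<inter> {0..1} \<in> sets \<mu>" if "E \<in> sets ?B" for E
    using measurable_sets[OF g_meas\<mu> that] by (simp add: P.space_\<mu>)
  have g01: "g y \<in> {0..1}" if "y \<in> {0..1}" for y using bij_betwE[OF bij] that by blast
  have "generated_measure m S \<rho> \<nu>"
    unfolding generated_measure_def
  proof (intro conjI ballI)
    show "space \<nu> = {0..1}" by (simp add: \<nu>_def space_restrict_space)
    show sets\<nu>: "sets \<nu> = sets ?B" by (simp add: \<nu>_def)
    have "g -` {0..1} \<inter> {0..1} = {0..1}" using g01 by auto
    then show "emeasure \<nu> {0..1} = 1"
      using \<nu>[of "{0..1}"] P.total_mass by (simp add: sets_restrict_space_iff)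
    fix E assume "E \<in> sets \<nu>"
    then have E: "E \<in> sets ?B" using sets\<nu> by simp
    \<comment> \<open>The conjugacy holds only on the hull of the support, but this suffices: the
      two preimages agree on the support, and sets that agree there have equal mass.\<close>
    have "emeasure \<mu> (\<phi> i -` (g -` E \<inter> {0..1}) \<inter> {0..1}) = emeasure \<nu> (S i -` E \<inter> {0..1})"
      if i: "i \<in> {1..m}" for i
    proof -
      have SE: "S i -` E \<inter> {0..1} \<in> sets ?B" using Q.vimage_measurable[OF i] E Q.sets_\<mu> by simp
      have "\<phi> i y \<in> g -` E \<inter> {0..1} \<longleftrightarrow> g y \<in> S i -` E \<inter> {0..1}" if "y \<in> P.K" for y
      proof -
        have "y \<in> {P.a..P.b}" "y \<in> {0..1}" using P.K_hull[OF that] P.K_subset that by auto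
        then show ?thesis using conj[OF i] into\<phi>[OF i] g01 by simp
      qed
      then show ?thesis
        unfolding \<nu>[OF SE]
        by (intro P.emeasure_cong_K P.vimage_measurable[OF i] g_vimage E SE) blast
    qed
    then show "emeasure \<nu> E = (\<Sum>i=1..m. ennreal (\<rho> i) * emeasure \<nu> (S i -` E \<inter> {0..1}))"
      using P.self_similar[OF g_vimage[OF E]] \<nu>[OF E] by simp
  qed
  note generated_\<nu> = this
  obtain r where r: "0 \<le> r" "r < 1" "\<And>i. i \<in> {1..m} \<Longrightarrow> \<bar>d i\<bar> \<le> r"
    using uniform_contraction_ratio[of m d] d(2) by blast
  have contr: "\<bar>S i y - S i z\<bar> \<le> r * \<bar>y - z\<bar>" if "i \<in> {1..m}" for i y z
  proof -
    have "S i y - S i z = d i * (y - z)" by (simp add: S right_diff_distrib)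
    then show ?thesis using r(3)[OF that] by (simp add: abs_mult mult_right_mono)
  qed
  have "\<nu> = \<mu>\<^sub>0"
    by (rule generated_measure_unique[OF generated_\<nu> assms(9) contS intoS contr r(1,2)])
  have "emeasure \<mu> E = emeasure \<mu>\<^sub>0 (g ` E)" if E: "E \<in> sets \<mu>" for E
  proof -
    have E01: "E \<subseteq> {0..1}" using E P.sets_\<mu>_iff by simp
    \<comment> \<open>Writing the image as a preimage under the continuous inverse shows that it is
      Borel, so the push-forward may be evaluated on it.\<close>
    have "g ` E = the_inv_into {0..1} g -` E \<inter> {0..1}"
    proof
      show "g ` E \<subseteq> the_inv_into {0..1} g -` E \<inter> {0..1}"
      proof (intro image_subsetI IntI vimageI2)
        fix y assume y: "y \<in> E"
        then have y01: "y \<in> {0..1}" using E01 by blast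
        show "the_inv_into {0..1} g (g y) \<in> E"
          using y the_inv_into_f_f[OF bij_betw_imp_inj_on[OF bij] y01] by simp
        show "g y \<in> {0..1}" using g01[OF y01] .
      qed
      show "the_inv_into {0..1} g -` E \<inter> {0..1} \<subseteq> g ` E"
      proof
        fix u assume u: "u \<in> the_inv_into {0..1} g -` E \<inter> {0..1}"
        then have "u = g (the_inv_into {0..1} g u)" using f_the_inv_into_f_bij_betw[OF bij] by simp
        then show "u \<in> g ` E" using u by blast
      qed
    qed
    then have gE: "g ` E \<in> sets ?B"
      using measurable_sets[OF inv_meas] E P.sets_\<mu> by (simp add: space_restrict_space)
    have "g -` (g ` E) \<inter> {0..1} = E"
      using E01 inj_on_image_mem_iff[OF bij_betw_imp_inj_on[OF bij]] by blast
    then show ?thesis using \<nu>[OF gE] \<open>\<nu> = \<mu>\<^sub>0\<close> by simp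
  qed
  then show ?thesis using diffeo by blast
qed

end
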